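(* Let $n\ge 2$ and let $S^n$ denote the unit sphere $\{x\in\mathbb{R}^n : |x|=1\}$ of $\mathbb{R}^n$. For any $p$ with $0<p<\infty$, any positive integer $m$, and any point $x_0$ on $S^n$, the space $\mathcal{P}(m,x_0)$ of harmonic polynomials on $\mathbb{R}^n$ that vanish at $x_0$ together with all their partial derivatives of order less than or equal to $m$ is dense (after restriction to $S^n$) in $L^p(S^n)$.
   Context: Following the paper's notation, $S^n$ is the unit sphere in $\mathbb{R}^n$ (not in $\mathbb{R}^{n+1}$). Functions are real-valued. $L^p(S^n)$ is the usual Lebesgue space on $S^n$ with respect to the surface area measure $\sigma$ on $S^n$; density means that for every $f\in L^p(S^n)$ and $\varepsilon>0$ there is $P\in\mathcal{P}(m,x_0)$ with $\int_{S^n}|f-P|^p\,d\sigma<\varepsilon$ (for $0<p<1$ this is density in the usual metric of $L^p$). *)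

theory Defs
  imports "HOL-Analysis.Analysis"
begin

(* The (n-1)-dimensional surface area measure on the Borel sets of the unit sphere of R^n, by the
   polar-coordinate normalisation sigma(A) = n * vol {t x | 0 < t < 1, x in A}. *)
definition sphere_measure :: "'a::euclidean_space measure" where
  "sphere_measure =
     scale_measure (of_nat DIM('a))
       (distr (restrict_space lborel (ball 0 1 - {0}))
              (restrict_space borel (sphere 0 1))
              (\<lambda>x. x /\<^sub>R norm x))"

lemma space_sphere_measure: "space sphere_measure = sphere 0 1"
  by (simp add: sphere_measure_def space_scale_measure space_restrict_space)

lemma sets_sphere_measure: "sets sphere_measure = sets (restrict_space borel (sphere 0 1))"
  by (simp add: sphere_measure_def)

lemma emeasure_sphere_measure:
  fixes A :: "'a::euclidean_space set"
  assumes "A \<in> sets borel" "A \<subseteq> sphere 0 1"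
  shows "emeasure sphere_measure A =
         of_nat DIM('a) * emeasure lborel {t *\<^sub>R x | t x. 0 < t \<and> t < 1 \<and> x \<in> A}"
proof -
  have "(\<lambda>x::'a. x /\<^sub>R norm x) \<in> restrict_space lborel (ball 0 1 - {0})
          \<rightarrow>\<^sub>M restrict_space borel (sphere 0 1)"
    by (rule measurable_restrict_space2)
       (auto simp: space_restrict_space intro!: measurable_restrict_space1)
  moreover have "A \<in> sets (restrict_space borel (sphere 0 1))"
    using assms by (auto simp: sets_restrict_space)
  moreover have "(\<lambda>x. x /\<^sub>R norm x) -` A \<inter> (ball 0 1 - {0})
      = {t *\<^sub>R x | t x. 0 < t \<and> t < 1 \<and> x \<in> A}" (is "?L = ?R")
  proof
    show "?L \<subseteq> ?R"
    proof
      fix y assume y: "y \<in> ?L"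
      then have "y = norm y *\<^sub>R (y /\<^sub>R norm y)" by simp
      with y show "y \<in> ?R" by (fastforce intro: exI[of _ "norm y"] exI[of _ "y /\<^sub>R norm y"])
    qed
    show "?R \<subseteq> ?L"
    proof
      fix y assume "y \<in> ?R"
      then obtain t x where "y = t *\<^sub>R x" "0 < t" "t < 1" "x \<in> A" by blast
      moreover from this have "norm x = 1" using assms(2) by auto
      ultimately show "y \<in> ?L" by auto
    qed
  qed
  ultimately show ?thesis
    by (simp add: sphere_measure_def emeasure_distr space_restrict_space emeasure_restrict_space)
       (subst emeasure_restrict_space; auto)
qed

(* Functions are not identified almost everywhere, and only their values on space M matter,
   so a function on R^n stands for its restriction to the sphere when M = sphere_measure. *)
definition Lp_space :: "'a measure \<Rightarrow> real \<Rightarrow> ('a \<Rightarrow> real) set" where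
  "Lp_space M p = {f \<in> borel_measurable M. integrable M (\<lambda>x. \<bar>f x\<bar> powr p)}"

definition dense_in_Lp :: "'a measure \<Rightarrow> real \<Rightarrow> ('a \<Rightarrow> real) set \<Rightarrow> bool" where
  "dense_in_Lp M p S \<longleftrightarrow>
     S \<subseteq> Lp_space M p \<and>
     (\<forall>f \<in> Lp_space M p. \<forall>\<epsilon>>0. \<exists>g\<in>S. (\<integral>x. \<bar>f x - g x\<bar> powr p \<partial>M) < \<epsilon>)"

definition partial_deriv :: "'n \<Rightarrow> (real ^ 'n \<Rightarrow> real) \<Rightarrow> real ^ 'n \<Rightarrow> real" where
  "partial_deriv i f x = deriv (\<lambda>t. f (x + t *\<^sub>R axis i 1)) 0"

definition laplacian :: "(real ^ 'n \<Rightarrow> real) \<Rightarrow> real ^ 'n \<Rightarrow> real" where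
  "laplacian f x = (\<Sum>i\<in>UNIV. partial_deriv i (partial_deriv i f) x)"

definition harmonic_polynomials :: "(real ^ 'n \<Rightarrow> real) set" where
  "harmonic_polynomials = {P. real_polynomial_function P \<and> (\<forall>x. laplacian P x = 0)}"

(* The list js = [i1, ..., ik] stands for the order-k partial derivative D_i1 ... D_ik;
   the empty list gives the condition P x0 = 0. *)
definition harmonic_polys_vanishing ::
    "nat \<Rightarrow> real ^ 'n \<Rightarrow> (real ^ 'n \<Rightarrow> real) set" where
  "harmonic_polys_vanishing m x0 =
     {P \<in> harmonic_polynomials. \<forall>js. length js \<le> m \<longrightarrow> foldr partial_deriv js P x0 = 0}"

end

theory Submission
  imports Defs
begin

text \<open>
  For a unit vector \<open>b\<close> orthogonal to \<open>x\<^sub>0\<close> put \<open>z = x\<^sub>0 \<bullet> x + \<i> (b \<bullet> x)\<close>. Since \<open>x\<^sub>0 + \<i> b\<close> is isotropic,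
  \<open>Re (F z)\<close> is a harmonic polynomial in \<open>x\<close> for each complex polynomial \<open>F\<close> of one variable. On the sphere
  \<open>\<bar>z\<bar> \<le> 1\<close> with \<open>z = 1\<close> only at \<open>x\<^sub>0\<close>, so the polynomials \<open>F z * (1 - ((1 + z) / 2) ^ N) ^ (m + 1)\<close> vanish to
  order \<open>m\<close> at \<open>x\<^sub>0\<close>, are uniformly bounded on the sphere, and tend to \<open>F z\<close> away from the null set \<open>{x\<^sub>0}\<close>;
  by dominated convergence \<open>Re (F z)\<close> lies in the \<open>L\<^sup>p\<close> closure of the space in question.

  Every harmonic polynomial is a linear combination of such functions: both are determined by their Cauchy data on
  the hyperplane orthogonal to \<open>x\<^sub>0\<close>, these data are linear combinations of powers of linear forms \<open>b \<bullet> x\<close>, and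
  for a single power the solution is the real or imaginary part of a power of \<open>z\<close>, up to a constant.
  Finally every polynomial agrees on the sphere with a harmonic one (again it is enough to treat powers of linear
  forms), and polynomials are dense in \<open>L\<^sup>p\<close>.
\<close>

section \<open>Polynomials as combinations of powers of linear forms\<close>

text \<open>Claims linear in a polynomial can be proved by induction over this span, so that only
  single powers of linear forms need computing. Constants enter through exponent 0.\<close>

inductive ridge_span :: "('a::euclidean_space \<Rightarrow> real) \<Rightarrow> bool" where
  ridge: "ridge_span (\<lambda>x. (a \<bullet> x) ^ k)"
| add: "ridge_span f \<Longrightarrow> ridge_span g \<Longrightarrow> ridge_span (\<lambda>x. f x + g x)"
| scale: "ridge_span f \<Longrightarrow> ridge_span (\<lambda>x. c * f x)"

text \<open>The combination \<open>q (2 * t) - 2 ^ Suc k * q t\<close> kills the top coefficient, which replaces the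
  Vandermonde determinant.\<close>

lemma ridge_span_coeffs:
  assumes "\<And>t::real. ridge_span (\<lambda>x. \<Sum>i\<le>k. t ^ i * v i x)" and "i \<le> k"
  shows "ridge_span (v i)"
  using assms
proof (induction k arbitrary: v i)
  case 0
  then show ?case using "0.prems"(1)[of 1] by simp
next
  case (Suc k)
  have low: "ridge_span (v j)" if "j \<le> k" for j
  proof -
    have "ridge_span (\<lambda>x. \<Sum>i\<le>k. t ^ i * ((2 ^ i - 2 ^ Suc k) * v i x))" for t
    proof -
      have "ridge_span (\<lambda>x. (\<Sum>i\<le>Suc k. (2 * t) ^ i * v i x) + (- (2 ^ Suc k)) * (\<Sum>i\<le>Suc k. t ^ i * v i x))"
        by (intro ridge_span.add ridge_span.scale Suc.prems)
      then show ?thesis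
        by (simp add: sum_distrib_left sum_subtractf sum_negf power_mult_distrib algebra_simps)
    qed
    from Suc.IH[OF this that] have "ridge_span (\<lambda>x. (2 ^ j - 2 ^ Suc k) * v j x)" .
    from ridge_span.scale[OF this, of "1 / (2 ^ j - 2 ^ Suc k)"]
    have "ridge_span (\<lambda>x. 1 / (2 ^ j - 2 ^ Suc k) * ((2 ^ j - 2 ^ Suc k) * v j x))" .
    moreover have "(2::real) ^ j - 2 ^ Suc k \<noteq> 0"
      using that power_strict_increasing[of j "Suc k" "2::real"] by auto
    ultimately show ?thesis by simp
  qed
  show ?case
  proof (cases "i \<le> k")
    case True then show ?thesis by (rule low)
  next
    case False
    have sums: "ridge_span (\<lambda>x. \<Sum>i\<le>j. v i x)" if "j \<le> k" for j
      using that
    proof (induction j)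
      case 0
      then show ?case using low by simp
    next
      case (Suc j)
      then show ?case using low[of "Suc j"] by (auto intro: ridge_span.add)
    qed
    \<comment> \<open>At \<open>t = 1\<close> the hypothesis gives the sum of all
      \<open>v i\<close>; subtracting the lower coefficients leaves the top one.\<close>
    have "ridge_span (\<lambda>x. (\<Sum>i\<le>Suc k. 1 ^ i * v i x) + (-1) * (\<Sum>i\<le>k. v i x))"
      by (intro ridge_span.add ridge_span.scale Suc.prems sums) auto
    then have "ridge_span (v (Suc k))" by simp
    with False Suc.prems(2) show ?thesis
      by (metis le_Suc_eq)
  qed
qed

text \<open>Polarisation: up to the factor \<open>Suc k\<close>, the product
  \<open>(b \<bullet> x) * (a \<bullet> x) ^ k\<close> is the coefficient of \<open>t\<close> in
  \<open>((a + t *\<^sub>R b) \<bullet> x) ^ Suc k\<close>, which lies in the span for every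
  \<open>t\<close>.\<close>

lemma ridge_span_mult_inner:
  assumes "ridge_span f"
  shows "ridge_span (\<lambda>x. (b \<bullet> x) * f x)"
  using assms
proof induction
  case (ridge a k)
  have eq: "((a + t *\<^sub>R b) \<bullet> x) ^ Suc k
      = (\<Sum>i\<le>Suc k. t ^ i * (real (Suc k choose i) * (b \<bullet> x) ^ i * (a \<bullet> x) ^ (Suc k - i)))" for t x
  proof -
    have "((a + t *\<^sub>R b) \<bullet> x) ^ Suc k = (t * (b \<bullet> x) + a \<bullet> x) ^ Suc k"
      by (simp add: inner_add_left algebra_simps)
    then show ?thesis
      unfolding binomial_ring by (simp add: power_mult_distrib mult_ac)
  qed
  have "ridge_span (\<lambda>x. \<Sum>i\<le>Suc k. t ^ i * (real (Suc k choose i) * (b \<bullet> x) ^ i * (a \<bullet> x) ^ (Suc k - i)))" for t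
    unfolding eq[symmetric] by (rule ridge_span.ridge)
  from ridge_span_coeffs[OF this, of 1]
  have "ridge_span (\<lambda>x. real (Suc k) * ((b \<bullet> x) * (a \<bullet> x) ^ k))" by (simp add: mult_ac)
  from ridge_span.scale[OF this, of "1 / real (Suc k)"]
  show ?case by (simp del: of_nat_Suc)
next
  case (add f g)
  then show ?case by (simp add: distrib_left ridge_span.add)
next
  case (scale f c)
  then show ?case using ridge_span.scale[of "\<lambda>x. (b \<bullet> x) * f x" c] by (simp add: mult_ac)
qed

lemma ridge_span_real_polynomial_function:
  fixes P :: "'a::euclidean_space \<Rightarrow> real"
  assumes "real_polynomial_function P"
  shows "ridge_span P"
proof -
  \<comment> \<open>With an arbitrary member \<open>f\<close> as second factor, a product of
    polynomials is handled by applying the two induction hypotheses in succession. Taking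
    \<open>f = 1\<close>, in the form \<open>(0 \<bullet> x) ^ 0\<close>, gives the claim.\<close>
  have "ridge_span (\<lambda>x. P x * f x)" if "ridge_span f" for f
    using assms that
  proof (induction arbitrary: f)
    case (linear g)
    interpret bounded_linear g by fact
    have "g x = adjoint g 1 \<bullet> x" for x
      using adjoint_works[OF linear_axioms, of x 1] by (simp add: inner_commute)
    then show ?case using ridge_span_mult_inner[OF linear.prems, of "adjoint g 1"] by simp
  next
    case (const c)
    then show ?case by (rule ridge_span.scale)
  next
    case (add g h)
    then show ?case by (simp add: distrib_right ridge_span.add)
  next
    case (mult g h)
    then show ?case by (simp add: mult.assoc)
  qed
  from this[OF ridge_span.ridge[of 0 0]] show ?thesis by simp
qed

section \<open>Harmonic polynomials on the sphere\<close>

lemma real_polynomial_function_inner: "real_polynomial_function (\<lambda>x. a \<bullet> x)"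
  by (intro real_polynomial_function.intros bounded_linear_inner_right)

lemma real_polynomial_function_component: "real_polynomial_function (\<lambda>x::real^'n. x $ j)"
  using real_polynomial_function_inner[of "axis j 1 :: real^'n"] by (simp add: inner_axis')

lemma real_polynomial_function_inner_self: "real_polynomial_function (\<lambda>x::real^'n. x \<bullet> x)"
  unfolding inner_vec_def inner_real_def
  by (intro real_polynomial_function_sum real_polynomial_function.intros real_polynomial_function_component) simp

lemmas real_polynomial_intros [intro] = real_polynomial_function.intros(2-) real_polynomial_function_power
  real_polynomial_function_inner real_polynomial_function_component real_polynomial_function_inner_self

section \<open>Partial derivatives of polynomial functions\<close>

lemma has_field_derivative_partial_deriv:
  fixes P :: "real ^ 'n \<Rightarrow> real"
  assumes "real_polynomial_function P"
  shows "((\<lambda>t. P (x + t *\<^sub>R axis i 1)) has_field_derivative partial_deriv i P x) (at 0)"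
    and "real_polynomial_function (partial_deriv i P)"
proof -
  \<comment> \<open>\<open>deriv\<close> alone does not certify differentiability, so the induction
    builds a polynomial that is the derivative at every point; \<open>partial_deriv i P\<close> is
    then identified with it.\<close>
  have "\<exists>Q. real_polynomial_function Q \<and>
      (\<forall>x. ((\<lambda>t. P (x + t *\<^sub>R axis i 1)) has_field_derivative Q x) (at 0))"
    using assms
  proof induction
    case (linear f)
    then interpret bounded_linear f .
    have "((\<lambda>t. f (x + t *\<^sub>R axis i 1)) has_field_derivative f (axis i 1)) (at 0)" for x
      unfolding add scaleR by (auto intro!: derivative_eq_intros)
    then show ?case by blast
  next
    case (const c)
    then show ?case by (intro exI[of _ "\<lambda>x. 0"]) auto
  next
    case (add f g)
    then obtain F G where "real_polynomial_function F" "real_polynomial_function G"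
      "\<And>x. ((\<lambda>t. f (x + t *\<^sub>R axis i 1)) has_field_derivative F x) (at 0)"
      "\<And>x. ((\<lambda>t. g (x + t *\<^sub>R axis i 1)) has_field_derivative G x) (at 0)"
      by blast
    then show ?case
      by (intro exI[of _ "\<lambda>x. F x + G x"]) (auto intro!: DERIV_add)
  next
    case (mult f g)
    then obtain F G where "real_polynomial_function F" "real_polynomial_function G"
      "\<And>x. ((\<lambda>t. f (x + t *\<^sub>R axis i 1)) has_field_derivative F x) (at 0)"
      "\<And>x. ((\<lambda>t. g (x + t *\<^sub>R axis i 1)) has_field_derivative G x) (at 0)"
      by blast
    with mult.hyps show ?case
      by (intro exI[of _ "\<lambda>x. F x * g x + G x * f x"]) (auto intro!: DERIV_mult[THEN DERIV_cong])
  qed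
  then obtain Q where Q: "real_polynomial_function Q"
    "\<And>x. ((\<lambda>t. P (x + t *\<^sub>R axis i 1)) has_field_derivative Q x) (at 0)"
    by blast
  then have "partial_deriv i P = Q"
    by (intro ext) (simp add: partial_deriv_def DERIV_imp_deriv)
  with Q show "((\<lambda>t. P (x + t *\<^sub>R axis i 1)) has_field_derivative partial_deriv i P x) (at 0)"
    and "real_polynomial_function (partial_deriv i P)"
    by auto
qed

lemmas real_polynomial_function_partial_deriv [intro] = has_field_derivative_partial_deriv(2)

lemma partial_deriv_eqI:
  assumes "\<And>x. ((\<lambda>t. f (x + t *\<^sub>R axis i 1)) has_field_derivative f' x) (at 0)"
  shows "partial_deriv i f = f'"
  using assms by (intro ext) (simp add: partial_deriv_def DERIV_imp_deriv)

lemma partial_deriv_add: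
  assumes "real_polynomial_function f" "real_polynomial_function g"
  shows "partial_deriv i (\<lambda>x. f x + g x) = (\<lambda>x. partial_deriv i f x + partial_deriv i g x)"
  using assms by (auto intro!: partial_deriv_eqI DERIV_add has_field_derivative_partial_deriv)

lemma partial_deriv_mult:
  assumes "real_polynomial_function f" "real_polynomial_function g"
  shows "partial_deriv i (\<lambda>x. f x * g x) = (\<lambda>x. partial_deriv i f x * g x + f x * partial_deriv i g x)"
  using assms
  by (auto intro!: partial_deriv_eqI DERIV_mult[THEN DERIV_cong] has_field_derivative_partial_deriv)

lemma partial_deriv_const: "partial_deriv i (\<lambda>x. c) = (\<lambda>x. 0)"
  by (auto intro!: partial_deriv_eqI)

lemma partial_deriv_inner: "partial_deriv i (\<lambda>x. a \<bullet> x) = (\<lambda>x. a $ i)"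
  by (rule partial_deriv_eqI)
    (auto simp: inner_add_right inner_axis intro!: derivative_eq_intros)

lemma partial_deriv_scale:
  assumes "real_polynomial_function f"
  shows "partial_deriv i (\<lambda>x. c * f x) = (\<lambda>x. c * partial_deriv i f x)"
  using assms by (simp add: partial_deriv_mult partial_deriv_const real_polynomial_intros)

lemma partial_deriv_power:
  assumes "real_polynomial_function f"
  shows "partial_deriv i (\<lambda>x. f x ^ k) = (\<lambda>x. real k * f x ^ (k - 1) * partial_deriv i f x)"
proof (induction k)
  case 0
  then show ?case by (simp add: partial_deriv_const)
next
  case (Suc k)
  have "partial_deriv i (\<lambda>x. f x ^ Suc k) = (\<lambda>x. partial_deriv i f x * f x ^ k + f x * partial_deriv i (\<lambda>x. f x ^ k) x)"
    unfolding power_Suc using assms by (intro partial_deriv_mult) auto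
  then show ?case
    unfolding Suc by (cases k) (simp_all add: algebra_simps)
qed

section \<open>Laplacians of products and powers\<close>

lemma laplacian_add:
  assumes "real_polynomial_function f" "real_polynomial_function g"
  shows "laplacian (\<lambda>x. f x + g x) x = laplacian f x + laplacian g x"
  using assms
  by (simp add: laplacian_def partial_deriv_add real_polynomial_function_partial_deriv sum.distrib)

lemma laplacian_scale:
  assumes "real_polynomial_function f"
  shows "laplacian (\<lambda>x. c * f x) x = c * laplacian f x"
  using assms
  by (simp add: laplacian_def partial_deriv_scale real_polynomial_function_partial_deriv sum_distrib_left)

lemma real_polynomial_function_laplacian [intro]:
  assumes "real_polynomial_function (f :: real ^ 'n \<Rightarrow> real)"
  shows "real_polynomial_function (laplacian f)"
proof -
  have "laplacian f = (\<lambda>x. \<Sum>i\<in>UNIV. partial_deriv i (partial_deriv i f) x)"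
    by (simp add: laplacian_def fun_eq_iff)
  with assms show ?thesis by (auto intro!: real_polynomial_function_sum)
qed

lemma laplacian_mult:
  assumes "real_polynomial_function f" "real_polynomial_function g"
  shows "laplacian (\<lambda>x. f x * g x) x =
    f x * laplacian g x + 2 * (\<Sum>i\<in>UNIV. partial_deriv i f x * partial_deriv i g x) + laplacian f x * g x"
  using assms
  by (simp add: laplacian_def partial_deriv_mult partial_deriv_add real_polynomial_function_partial_deriv
      real_polynomial_intros sum.distrib sum_distrib_left sum_distrib_right algebra_simps
      flip: mult_2)

text \<open>Truncated subtraction is harmless here: for \<open>k < 2\<close> the factor
  \<open>real k * real (k - 1)\<close> is 0.\<close>

lemma laplacian_inner_power:
  "laplacian (\<lambda>x. (a \<bullet> x) ^ k) x = real k * real (k - 1) * (a \<bullet> a) * (a \<bullet> x) ^ (k - 2)"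
  by (simp add: laplacian_def partial_deriv_power partial_deriv_inner partial_deriv_scale partial_deriv_mult
      partial_deriv_const real_polynomial_intros
      real_polynomial_function_inner real_polynomial_function_power
      inner_vec_def[of a a] sum_distrib_left sum_distrib_right mult_ac numeral_2_eq_2)

lemma partial_deriv_component: "partial_deriv i (\<lambda>x. x $ j) = (\<lambda>x. if i = j then 1 else 0)"
proof -
  have "partial_deriv i (\<lambda>x. x $ j) = (\<lambda>x. axis j 1 $ i)"
    using partial_deriv_inner[of i "axis j 1"] by (simp add: inner_axis')
  then show ?thesis by (auto simp: axis_def)
qed

lemma partial_deriv_inner_self: "partial_deriv i (\<lambda>x. x \<bullet> x) = (\<lambda>x. 2 * x $ i)"
  by (rule partial_deriv_eqI)
    (auto simp: inner_add_right inner_add_left inner_axis inner_axis' intro!: derivative_eq_intros)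

lemma laplacian_inner_self_power:
  "laplacian (\<lambda>x::real^'n. (x \<bullet> x) ^ Suc j) x =
    2 * real (Suc j) * (real CARD('n) + 2 * real j) * (x \<bullet> x) ^ j"
proof -
  have "partial_deriv i (\<lambda>x::real^'n. (x \<bullet> x) ^ Suc j) = (\<lambda>x. (2 * real (Suc j)) * ((x \<bullet> x) ^ j * x $ i))" for i
    by (subst partial_deriv_power) (auto simp: partial_deriv_inner_self)
  then have "laplacian (\<lambda>x::real^'n. (x \<bullet> x) ^ Suc j) x
     = (\<Sum>i\<in>UNIV. (2 * real (Suc j)) * ((real j * (x \<bullet> x) ^ (j - 1) * (2 * x $ i)) * x $ i + (x \<bullet> x) ^ j))"
    unfolding laplacian_def
    by (simp add: partial_deriv_scale partial_deriv_mult partial_deriv_power partial_deriv_inner_self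
        partial_deriv_component real_polynomial_intros del: power_Suc of_nat_Suc)
  also have "\<dots> = (\<Sum>i\<in>UNIV. (1 + real j) * ((x \<bullet> x) ^ j * 2 + 4 * real j * (x \<bullet> x) ^ (j - 1) * (x $ i * x $ i)))"
    by (simp add: algebra_simps)
  also have "\<dots> = (1 + real j) * (2 * real CARD('n) * (x \<bullet> x) ^ j + 4 * real j * (x \<bullet> x) ^ (j - 1) * (x \<bullet> x))"
    by (simp add: sum_distrib_left[symmetric] sum.distrib inner_vec_def)
  finally show ?thesis by (cases j) (simp_all add: algebra_simps)
qed

text \<open>The gradients of \<open>x \<bullet> x\<close> and \<open>a \<bullet> x\<close> have
  inner product \<open>2 * (a \<bullet> x)\<close>, so the mixed term of the product rule only adds
  to the first coefficient. The second term has its degree in \<open>a \<bullet> x\<close> lowered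
  by 2, which allows the Poisson equation to be solved by recursion on \<open>l\<close>.\<close>

lemma laplacian_zonal:
  fixes a :: "real ^ 'n"
  shows "laplacian (\<lambda>x. (x \<bullet> x) ^ Suc j * (a \<bullet> x) ^ l) x =
     2 * real (Suc j) * (real CARD('n) + 2 * real j + 2 * real l) * ((x \<bullet> x) ^ j * (a \<bullet> x) ^ l)
     + real l * real (l - 1) * (a \<bullet> a) * ((x \<bullet> x) ^ Suc j * (a \<bullet> x) ^ (l - 2))"
proof -
  have "(\<Sum>i\<in>UNIV. partial_deriv i (\<lambda>x. (x \<bullet> x) ^ Suc j) x * partial_deriv i (\<lambda>x. (a \<bullet> x) ^ l) x)
     = (\<Sum>i\<in>UNIV. (2 * real (Suc j) * real l * (x \<bullet> x) ^ j * (a \<bullet> x) ^ (l - 1)) * (a $ i * x $ i))"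
    by (simp add: partial_deriv_power real_polynomial_intros
        partial_deriv_inner_self partial_deriv_inner algebra_simps del: power_Suc)
  also have "\<dots> = 2 * real (Suc j) * real l * (x \<bullet> x) ^ j * ((a \<bullet> x) ^ (l - 1) * (a \<bullet> x))"
    by (simp add: sum_distrib_left[symmetric] inner_vec_def[of a x])
  finally have "(\<Sum>i\<in>UNIV. partial_deriv i (\<lambda>x. (x \<bullet> x) ^ Suc j) x * partial_deriv i (\<lambda>x. (a \<bullet> x) ^ l) x)
     = 2 * real (Suc j) * real l * (x \<bullet> x) ^ j * (a \<bullet> x) ^ l"
    by (cases l) (auto simp: mult_ac)
  then show ?thesis
    by (subst laplacian_mult)
      (auto simp: laplacian_inner_self_power laplacian_inner_power algebra_simps simp del: power_Suc)
qed

lemma harmonic_polynomials_real_polynomial_function: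
  "P \<in> harmonic_polynomials \<Longrightarrow> real_polynomial_function P"
  by (simp add: harmonic_polynomials_def)

lemma harmonic_polynomials_add:
  "P \<in> harmonic_polynomials \<Longrightarrow> Q \<in> harmonic_polynomials \<Longrightarrow> (\<lambda>x. P x + Q x) \<in> harmonic_polynomials"
  by (auto simp: harmonic_polynomials_def laplacian_add)

lemma harmonic_polynomials_scale:
  "P \<in> harmonic_polynomials \<Longrightarrow> (\<lambda>x. c * P x) \<in> harmonic_polynomials"
  by (auto simp: harmonic_polynomials_def laplacian_scale)

text \<open>Every term of the solution carries a factor \<open>x \<bullet> x\<close>, which is \<open>1\<close> on the sphere, so only
  powers of \<open>a \<bullet> x\<close> of degree at most \<open>l\<close> remain there.\<close>

lemma laplacian_zonal_solve:
  fixes a :: "real ^ 'n"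
  shows "\<exists>q c. real_polynomial_function q \<and> (\<forall>x. laplacian q x = (x \<bullet> x) ^ j * (a \<bullet> x) ^ l)
    \<and> (\<forall>x\<in>sphere 0 1. q x = (\<Sum>m\<le>l. c m * (a \<bullet> x) ^ m))"
\<comment> \<open>\<open>j\<close> must vary, since the remainder in \<open>laplacian_zonal\<close>
  carries the exponent \<open>Suc j\<close>.\<close>
proof (induction l arbitrary: j rule: less_induct)
  case (less l)
  let ?r = "2 * real (Suc j) * (real CARD('n) + 2 * real j + 2 * real l)"
  have r: "?r \<noteq> 0"
    using zero_less_card_finite[where 'a='n] by (auto simp: add_nonneg_eq_0_iff simp del: of_nat_Suc)
  \<comment> \<open>This \<open>q\<close> absorbs the second term of \<open>laplacian_zonal\<close>:
    a multiple of the solution for \<open>l - 2\<close> and \<open>Suc j\<close>, or 0 when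
    \<open>l < 2\<close>.\<close>
  have "\<exists>q c. real_polynomial_function q
      \<and> (\<forall>x. laplacian q x = real l * real (l - 1) * (a \<bullet> a) * ((x \<bullet> x) ^ Suc j * (a \<bullet> x) ^ (l - 2)))
      \<and> (\<forall>x\<in>sphere 0 1. q x = (\<Sum>m\<le>l. c m * (a \<bullet> x) ^ m))"
  proof (cases "l < 2")
    case True
    then have "real l * real (l - 1) = 0" by (cases l) auto
    then show ?thesis
      by (intro exI[of _ "\<lambda>x. 0"]) (auto simp: laplacian_def partial_deriv_const intro!: exI[of _ "\<lambda>x. 0"])
  next
    case False
    then obtain q c where q: "real_polynomial_function q"
      "\<And>x. laplacian q x = (x \<bullet> x) ^ Suc j * (a \<bullet> x) ^ (l - 2)"
      "\<And>x. x \<in> sphere 0 1 \<Longrightarrow> q x = (\<Sum>m\<le>l - 2. c m * (a \<bullet> x) ^ m)"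
      using less.IH[of "l - 2" "Suc j"] by auto
    let ?s = "real l * real (l - 1) * (a \<bullet> a)"
    have "?s * q x = (\<Sum>m\<le>l. (if m \<le> l - 2 then ?s * c m else 0) * (a \<bullet> x) ^ m)" if "x \<in> sphere 0 1" for x
      unfolding q(3)[OF that] sum_distrib_left
      by (rule sum.mono_neutral_cong_left) auto
    with q show ?thesis
      by (intro exI[of _ "\<lambda>x. ?s * q x"] exI[of _ "\<lambda>m. if m \<le> l - 2 then ?s * c m else 0"])
        (auto simp: laplacian_scale)
  qed
  then obtain q c where q: "real_polynomial_function q"
    "\<And>x. laplacian q x = real l * real (l - 1) * (a \<bullet> a) * ((x \<bullet> x) ^ Suc j * (a \<bullet> x) ^ (l - 2))"
    "\<And>x. x \<in> sphere 0 1 \<Longrightarrow> q x = (\<Sum>m\<le>l. c m * (a \<bullet> x) ^ m)"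
    by blast
  define Q where "Q x = inverse ?r * ((x \<bullet> x) ^ Suc j * (a \<bullet> x) ^ l + (-1) * q x)" for x
  have poly: "real_polynomial_function (\<lambda>x. (x \<bullet> x) ^ Suc j * (a \<bullet> x) ^ l)"
    by (intro real_polynomial_intros)
  have "real_polynomial_function Q"
    unfolding Q_def by (intro real_polynomial_intros q(1))
  moreover have "laplacian Q x = (x \<bullet> x) ^ j * (a \<bullet> x) ^ l" for x
  proof -
    have "laplacian Q x = inverse ?r * (laplacian (\<lambda>x. (x \<bullet> x) ^ Suc j * (a \<bullet> x) ^ l) x + (-1) * laplacian q x)"
      unfolding Q_def using q(1) poly
      by (simp only: laplacian_scale laplacian_add real_polynomial_function.intros(2-))
    also have "\<dots> = inverse ?r * (?r * ((x \<bullet> x) ^ j * (a \<bullet> x) ^ l))"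
      unfolding laplacian_zonal q(2) by simp
    also have "\<dots> = (x \<bullet> x) ^ j * (a \<bullet> x) ^ l"
      by (simp only: mult.assoc[of "inverse ?r" ?r, symmetric] left_inverse[OF r] mult_1_left)
    finally show ?thesis .
  qed
  moreover have "Q x = (\<Sum>m\<le>l. (inverse ?r * ((if m = l then 1 else 0) - c m)) * (a \<bullet> x) ^ m)"
    if "x \<in> sphere 0 1" for x
  proof -
    have "x \<bullet> x = 1" using that by (simp add: norm_eq_1)
    moreover have "(\<Sum>m\<le>l. (if m = l then 1 else 0) * (a \<bullet> x) ^ m) = (\<Sum>m\<le>l. if m = l then (a \<bullet> x) ^ m else 0)"
      by (intro sum.cong) auto
    ultimately have "Q x = inverse ?r * ((\<Sum>m\<le>l. (if m = l then 1 else 0) * (a \<bullet> x) ^ m) - (\<Sum>m\<le>l. c m * (a \<bullet> x) ^ m))"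
      unfolding Q_def q(3)[OF that] by simp
    then show ?thesis
      by (simp only: sum_subtractf sum_distrib_left left_diff_distrib right_diff_distrib mult.assoc)
  qed
  ultimately show ?case by (intro exI[of _ Q] exI[of _ "\<lambda>m. inverse ?r * ((if m = l then 1 else 0) - c m)"]) blast
qed

text \<open>Subtracting a multiple of some \<open>q\<close> whose Laplacian is
  \<open>(a \<bullet> x) ^ (k - 2)\<close> makes the power harmonic. On the sphere \<open>q\<close>
  is a combination of powers of degree at most \<open>k - 2\<close>; by induction these agree there
  with harmonic polynomials, so the loss can be added back.\<close>

lemma inner_power_eq_harmonic_on_sphere:
  fixes a :: "real ^ 'n"
  shows "\<exists>h\<in>harmonic_polynomials. \<forall>x\<in>sphere 0 1. h x = (a \<bullet> x) ^ k"
proof (induction k rule: less_induct)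
  case (less k)
  show ?case
  proof (cases "k < 2")
    case True
    then have "real k * real (k - 1) = 0" by (cases k) auto
    then have "(\<lambda>x. (a \<bullet> x) ^ k) \<in> harmonic_polynomials"
      by (auto simp: harmonic_polynomials_def laplacian_inner_power)
    then show ?thesis by (intro bexI) auto
  next
    case False
    obtain q c where q: "real_polynomial_function q"
      "\<And>x. laplacian q x = (x \<bullet> x) ^ 0 * (a \<bullet> x) ^ (k - 2)"
      "\<And>x. x \<in> sphere 0 1 \<Longrightarrow> q x = (\<Sum>m\<le>k - 2. c m * (a \<bullet> x) ^ m)"
      using laplacian_zonal_solve[of 0 a "k - 2"] by blast
    let ?s = "- (real k * real (k - 1) * (a \<bullet> a))"
    have "laplacian (\<lambda>x. (a \<bullet> x) ^ k + ?s * q x) x = 0" for x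
      by (simp only: laplacian_add laplacian_scale laplacian_inner_power q real_polynomial_intros) simp
    moreover have "real_polynomial_function (\<lambda>x. (a \<bullet> x) ^ k + ?s * q x)"
      by (intro real_polynomial_intros q(1))
    ultimately have "(\<lambda>x. (a \<bullet> x) ^ k + ?s * q x) \<in> harmonic_polynomials"
      by (simp add: harmonic_polynomials_def)
    moreover have "\<exists>h\<in>harmonic_polynomials. \<forall>x\<in>sphere 0 1. h x = (\<Sum>m\<le>j. c m * (a \<bullet> x) ^ m)"
      if "j < k" for j
      using that
    proof (induction j)
      case 0
      have "(\<lambda>x. c 0) \<in> harmonic_polynomials"
        by (auto simp: harmonic_polynomials_def laplacian_def partial_deriv_const)
      then show ?case by (intro bexI) auto
    next
      case (Suc j)
      then obtain h where h: "h \<in> harmonic_polynomials" "\<And>x. x\<in>sphere 0 1 \<Longrightarrow> h x = (\<Sum>m\<le>j. c m * (a \<bullet> x) ^ m)"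
        by auto
      obtain h' where h': "h' \<in> harmonic_polynomials" "\<And>x. x\<in>sphere 0 1 \<Longrightarrow> h' x = (a \<bullet> x) ^ Suc j"
        using less.IH[OF Suc.prems] by blast
      show ?case
        using h h'
        by (intro bexI[of _ "\<lambda>x. h x + c (Suc j) * h' x"] harmonic_polynomials_add harmonic_polynomials_scale) auto
    qed
    then obtain h where h: "h \<in> harmonic_polynomials" "\<And>x. x\<in>sphere 0 1 \<Longrightarrow> h x = (\<Sum>m\<le>k - 2. c m * (a \<bullet> x) ^ m)"
      using False by (metis diff_less less_le_trans linorder_not_less pos2)
    ultimately have "(\<lambda>x. ((a \<bullet> x) ^ k + ?s * q x) + (- ?s) * h x) \<in> harmonic_polynomials"
      by (intro harmonic_polynomials_add[OF _ harmonic_polynomials_scale[OF h(1)]])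
    then show ?thesis
      using q(3) h(2) by (intro bexI) auto
  qed
qed

lemma real_polynomial_function_eq_harmonic_on_sphere:
  fixes P :: "real ^ 'n \<Rightarrow> real"
  assumes "real_polynomial_function P"
  shows "\<exists>h\<in>harmonic_polynomials. \<forall>x\<in>sphere 0 1. h x = P x"
  using ridge_span_real_polynomial_function[OF assms]
proof induction
  case (ridge a k)
  show ?case by (rule inner_power_eq_harmonic_on_sphere)
next
  case (add f g)
  then obtain F G where "F \<in> harmonic_polynomials" "G \<in> harmonic_polynomials"
    "\<forall>x\<in>sphere 0 1. F x = f x" "\<forall>x\<in>sphere 0 1. G x = g x" by blast
  then show ?case by (intro bexI[of _ "\<lambda>x. F x + G x"] harmonic_polynomials_add) auto
next
  case (scale f c)
  then obtain F where "F \<in> harmonic_polynomials" "\<forall>x\<in>sphere 0 1. F x = f x" by blast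
  then show ?case by (intro bexI[of _ "\<lambda>x. c * F x"] harmonic_polynomials_scale) auto
qed

section \<open>Harmonic polynomials as superpositions of plane waves\<close>

text \<open>Imaginary parts are included: replacing \<open>F\<close> by \<open>smult \<i> F\<close>
  yields minus the imaginary part.\<close>

definition wave :: "complex poly \<Rightarrow> real ^ 'n \<Rightarrow> real ^ 'n \<Rightarrow> real ^ 'n \<Rightarrow> real" where
  "wave F a b x = Re (poly F (Complex (a \<bullet> x) (b \<bullet> x)))"

lemma real_polynomial_function_wave: "real_polynomial_function (wave F a b)"
proof -
  let ?z = "\<lambda>x. Complex (a \<bullet> x) (b \<bullet> x)"
  \<comment> \<open>Both parts are treated together because the Horner recursion mixes them.\<close>
  have "real_polynomial_function (\<lambda>x. Re (poly F (?z x))) \<and> real_polynomial_function (\<lambda>x. Im (poly F (?z x)))"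
  proof (induction F)
    case 0
    then show ?case by auto
  next
    case (pCons c F)
    then have "real_polynomial_function (\<lambda>x. Re c + ((a \<bullet> x) * Re (poly F (?z x)) + (-1) * ((b \<bullet> x) * Im (poly F (?z x)))))"
      and "real_polynomial_function (\<lambda>x. Im c + ((a \<bullet> x) * Im (poly F (?z x)) + (b \<bullet> x) * Re (poly F (?z x))))"
      by (intro real_polynomial_intros; simp)+
    then show ?case by simp
  qed
  then show ?thesis by (simp add: wave_def[abs_def])
qed

text \<open>Along the \<open>i\<close>-th axis the argument of \<open>F\<close> moves with constant
  complex velocity \<open>Complex (a $ i) (b $ i)\<close>, so the chain rule stays within
  waves.\<close>

lemma partial_deriv_wave:
  "partial_deriv i (wave F a b) = wave (smult (Complex (a $ i) (b $ i)) (pderiv F)) a b"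
proof (rule partial_deriv_eqI)
  fix x
  let ?w = "Complex (a $ i) (b $ i)" and ?z = "Complex (a \<bullet> x) (b \<bullet> x)"
  have "((\<lambda>t. ?z + of_real t * ?w) has_vector_derivative ?w) (at 0)"
    by (auto intro!: derivative_eq_intros simp: has_vector_derivative_def scaleR_conv_of_real)
  from field_vector_diff_chain_at[OF this poly_DERIV]
  have "(poly F \<circ> (\<lambda>t. ?z + of_real t * ?w) has_vector_derivative ?w * poly (pderiv F) ?z) (at 0)"
    by simp
  from bounded_linear.has_vector_derivative[OF bounded_linear_Re this]
  have "((\<lambda>t. Re (poly F (?z + of_real t * ?w))) has_field_derivative Re (?w * poly (pderiv F) ?z)) (at 0)"
    by (simp add: has_real_derivative_iff_has_vector_derivative o_def)
  moreover have "?z + of_real t * ?w = Complex (a \<bullet> (x + t *\<^sub>R axis i 1)) (b \<bullet> (x + t *\<^sub>R axis i 1))" for t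
    by (simp add: complex_eq_iff inner_add_right inner_axis)
  ultimately show "((\<lambda>t. wave F a b (x + t *\<^sub>R axis i 1)) has_field_derivative
      wave (smult ?w (pderiv F)) a b x) (at 0)"
    by (simp add: wave_def)
qed

text \<open>Two derivatives along each axis produce the sum of the squares
  \<open>(Complex (a $ i) (b $ i))\<^sup>2\<close> as a factor. It has real part
  \<open>a \<bullet> a - b \<bullet> b\<close> and imaginary part
  \<open>2 * (a \<bullet> b)\<close>, hence is 0.\<close>

lemma wave_harmonic:
  assumes "norm a = 1" "norm b = 1" "a \<bullet> b = 0"
  shows "wave F a b \<in> harmonic_polynomials"
proof -
  have "(\<Sum>i\<in>UNIV. (Complex (a $ i) (b $ i))\<^sup>2) = Complex (a \<bullet> a - b \<bullet> b) (2 * (a \<bullet> b))"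
    by (simp add: complex_eq_iff inner_vec_def power2_eq_square sum_subtractf sum_distrib_left mult_ac)
  then have iso: "(\<Sum>i\<in>UNIV. (Complex (a $ i) (b $ i))\<^sup>2) = 0"
    using assms by (simp add: norm_eq_1 complex_eq_iff)
  have "laplacian (wave F a b) x
      = Re ((\<Sum>i\<in>UNIV. (Complex (a $ i) (b $ i))\<^sup>2) * poly (pderiv (pderiv F)) (Complex (a \<bullet> x) (b \<bullet> x)))" for x
    by (simp add: laplacian_def partial_deriv_wave pderiv_smult sum_distrib_right wave_def power2_eq_square
        mult.assoc)
  then show ?thesis
    by (simp add: harmonic_polynomials_def real_polynomial_function_wave iso)
qed

section \<open>Order of vanishing of waves\<close>

lemma power_dvd_pderiv:
  fixes F :: "'a::idom poly"
  assumes "p ^ Suc n dvd F"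
  shows "p ^ n dvd pderiv F"
proof -
  from assms obtain G where "F = p ^ n * (p * G)" by (auto simp: dvd_def mult_ac)
  then have "pderiv F = p ^ n * pderiv (p * G) + (p * G) * pderiv (p ^ n)"
    by (simp add: pderiv_mult)
  moreover have "p ^ n dvd (p * G) * pderiv (p ^ n)"
  proof (cases n)
    case (Suc k)
    then have "(p * G) * pderiv (p ^ n) = p ^ n * (smult (of_nat n) (G * pderiv p))"
      by (simp add: pderiv_power_Suc mult_ac del: of_nat_Suc power_Suc) (simp add: mult_ac)
    then show ?thesis by (metis dvd_triv_left)
  qed simp
  ultimately show ?thesis by simp
qed

text \<open>Each partial derivative differentiates the polynomial once and costs at most one factor
  \<open>[:-1, 1:]\<close>; \<open>n\<close> counts the factors guaranteed to survive.\<close>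

lemma foldr_partial_deriv_wave:
  assumes "[:-1, 1:] ^ (n + length js) dvd F"
  shows "\<exists>G. [:-1, 1:] ^ n dvd G \<and> foldr partial_deriv js (wave F a b) = wave G a b"
  using assms
proof (induction js arbitrary: n)
  case Nil
  then show ?case by auto
next
  case (Cons j js)
  then obtain G where "[:-1, 1:] ^ Suc n dvd G" "foldr partial_deriv js (wave F a b) = wave G a b"
    using Cons.IH[of "Suc n"] by auto
  then show ?case
    by (intro exI[of _ "smult (Complex (a $ j) (b $ j)) (pderiv G)"])
      (simp add: partial_deriv_wave dvd_smult power_dvd_pderiv del: power_Suc)
qed

text \<open>At \<open>x = a\<close> the argument of \<open>F\<close> equals 1, and after at most
  \<open>m\<close> derivatives at least one of the \<open>Suc m\<close> factors
  \<open>[:-1, 1:]\<close> remains.\<close>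

lemma wave_vanishing:
  assumes "norm a = 1" "norm b = 1" "a \<bullet> b = 0" and "[:-1, 1:] ^ Suc m dvd F"
  shows "wave F a b \<in> harmonic_polys_vanishing m a"
proof -
  have "foldr partial_deriv js (wave F a b) a = 0" if "length js \<le> m" for js
  proof -
    have "[:-1, 1:] ^ (1 + length js) dvd F"
      using that by (intro dvd_trans[OF le_imp_power_dvd assms(4)]) simp
    then obtain G where "[:-1, 1:] dvd G" "foldr partial_deriv js (wave F a b) = wave G a b"
      using foldr_partial_deriv_wave[of 1 js F a b] by auto
    moreover from this have "poly G 1 = 0" by (simp add: poly_eq_0_iff_dvd)
    moreover have "Complex (a \<bullet> a) (b \<bullet> a) = 1"
      using assms by (simp add: norm_eq_1 inner_commute complex_eq_iff)
    ultimately show ?thesis by (simp add: wave_def)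
  qed
  then show ?thesis
    using wave_harmonic[OF assms(1-3)] by (simp add: harmonic_polys_vanishing_def)
qed

section \<open>Linear combinations of vanishing polynomials and of waves\<close>

lemma foldr_partial_deriv_polynomial:
  assumes "real_polynomial_function f"
  shows "real_polynomial_function (foldr partial_deriv js f)"
  by (induction js) (auto simp: assms)

lemma foldr_partial_deriv_add:
  assumes "real_polynomial_function f" "real_polynomial_function g"
  shows "foldr partial_deriv js (\<lambda>x. f x + g x)
    = (\<lambda>x. foldr partial_deriv js f x + foldr partial_deriv js g x)"
  by (induction js) (simp_all add: partial_deriv_add foldr_partial_deriv_polynomial assms)

lemma foldr_partial_deriv_scale:
  assumes "real_polynomial_function f"
  shows "foldr partial_deriv js (\<lambda>x. c * f x) = (\<lambda>x. c * foldr partial_deriv js f x)"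
  by (induction js) (simp_all add: partial_deriv_scale foldr_partial_deriv_polynomial assms)

lemma harmonic_polys_vanishing_add:
  "P \<in> harmonic_polys_vanishing m a \<Longrightarrow> Q \<in> harmonic_polys_vanishing m a \<Longrightarrow>
    (\<lambda>x. P x + Q x) \<in> harmonic_polys_vanishing m a"
  by (simp add: harmonic_polys_vanishing_def harmonic_polynomials_add foldr_partial_deriv_add
      harmonic_polynomials_real_polynomial_function)

lemma harmonic_polys_vanishing_scale:
  "P \<in> harmonic_polys_vanishing m a \<Longrightarrow> (\<lambda>x. c * P x) \<in> harmonic_polys_vanishing m a"
  by (simp add: harmonic_polys_vanishing_def harmonic_polynomials_scale foldr_partial_deriv_scale
      harmonic_polynomials_real_polynomial_function)

inductive wave_span :: "real ^ 'n \<Rightarrow> (real ^ 'n \<Rightarrow> real) \<Rightarrow> bool" for a where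
  wave: "norm b = 1 \<Longrightarrow> a \<bullet> b = 0 \<Longrightarrow> wave_span a (wave F a b)"
| add: "wave_span a f \<Longrightarrow> wave_span a g \<Longrightarrow> wave_span a (\<lambda>x. f x + g x)"
| scale: "wave_span a f \<Longrightarrow> wave_span a (\<lambda>x. c * f x)"

lemma wave_span_harmonic:
  assumes "wave_span a f" "norm a = 1"
  shows "f \<in> harmonic_polynomials"
  using assms(1)
  by induction (auto simp: assms(2) wave_harmonic harmonic_polynomials_add harmonic_polynomials_scale)

text \<open>With \<open>u = b \<bullet> x\<close> and \<open>s = a \<bullet> x\<close> this expands
  \<open>(u - \<i> * s) ^ k\<close> modulo \<open>s\<^sup>2\<close>. Multiplying once more by
  \<open>u - \<i> * s\<close> gives recursions for the remainders, which therefore stay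
  polynomial.\<close>

lemma power_inner_mod_square:
  fixes a b :: "'a::euclidean_space"
  shows "\<exists>A B. real_polynomial_function A \<and> real_polynomial_function B \<and>
    (\<forall>x. Complex (b \<bullet> x) (- (a \<bullet> x)) ^ k =
       Complex ((b \<bullet> x) ^ k + (a \<bullet> x)\<^sup>2 * A x) (- (real k * (a \<bullet> x) * (b \<bullet> x) ^ (k - 1)) + (a \<bullet> x)\<^sup>2 * B x))"
proof (induction k)
  case 0
  then show ?case by (intro exI[of _ "\<lambda>x. 0"]) (auto simp: complex_eq_iff)
next
  case (Suc k)
  then obtain A B where AB: "real_polynomial_function A" "real_polynomial_function B"
    "\<And>x. Complex (b \<bullet> x) (- (a \<bullet> x)) ^ k =
       Complex ((b \<bullet> x) ^ k + (a \<bullet> x)\<^sup>2 * A x) (- (real k * (a \<bullet> x) * (b \<bullet> x) ^ (k - 1)) + (a \<bullet> x)\<^sup>2 * B x)"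
    by blast
  have "real_polynomial_function (\<lambda>x. (b \<bullet> x) * A x + ((- real k) * (b \<bullet> x) ^ (k - 1) + (a \<bullet> x) * B x))"
    "real_polynomial_function (\<lambda>x. (b \<bullet> x) * B x + (-1) * ((a \<bullet> x) * A x))"
    by (intro real_polynomial_intros AB)+
  moreover have "Complex (b \<bullet> x) (- (a \<bullet> x)) ^ Suc k = Complex
      ((b \<bullet> x) ^ Suc k + (a \<bullet> x)\<^sup>2 * ((b \<bullet> x) * A x + ((- real k) * (b \<bullet> x) ^ (k - 1) + (a \<bullet> x) * B x)))
      (- (real (Suc k) * (a \<bullet> x) * (b \<bullet> x) ^ (Suc k - 1)) + (a \<bullet> x)\<^sup>2 * ((b \<bullet> x) * B x + (-1) * ((a \<bullet> x) * A x)))" for x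
    unfolding power_Suc AB(3)
    by (cases k) (simp_all add: complex_eq_iff algebra_simps power2_eq_square)
  ultimately show ?case by blast
qed

text \<open>The real and imaginary parts of \<open>((b \<bullet> x) - \<i> (a \<bullet> x)) ^ k\<close> realise the Cauchy data \<open>((b \<bullet> x) ^ k, 0)\<close>
  and \<open>(0, (b \<bullet> x) ^ (k - 1))\<close>, the latter up to a factor, on the hyperplane \<open>a \<bullet> x = 0\<close>; agreement of Cauchy
  data is expressed as congruence modulo \<open>(a \<bullet> x)\<^sup>2\<close>.\<close>

lemma wave_span_cauchy_data:
  fixes a b :: "real ^ 'n"
  assumes "CARD('n) \<ge> 2" "norm a = 1" "a \<bullet> b = 0"
  shows "\<exists>v R. wave_span a v \<and> real_polynomial_function R \<and> (\<forall>x. v x = (b \<bullet> x) ^ k + (a \<bullet> x)\<^sup>2 * R x)"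
    and "\<exists>v R. wave_span a v \<and> real_polynomial_function R \<and> (\<forall>x. v x = (a \<bullet> x) * (b \<bullet> x) ^ k + (a \<bullet> x)\<^sup>2 * R x)"
proof -
  \<comment> \<open>The direction of \<open>b\<close>, or for \<open>b = 0\<close> any unit vector
    orthogonal to \<open>a\<close>; dimension at least 2 supplies one.\<close>
  obtain u where u: "norm u = 1" "a \<bullet> u = 0" "b = norm b *\<^sub>R u"
  proof (cases "b = 0")
    case True
    obtain y where "y \<noteq> 0" "orthogonal a y"
      using orthogonal_to_vector_exists[of a] assms(1) by auto
    then show ?thesis using True by (intro that[of "y /\<^sub>R norm y"]) (auto simp: orthogonal_def)
  next
    case False
    then show ?thesis using assms(3) by (intro that[of "b /\<^sub>R norm b"]) auto
  qed
  have b: "b \<bullet> x = norm b * (u \<bullet> x)" for x using u(3) by (metis inner_scaleR_left)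
  \<comment> \<open>Multiplication by \<open>-\<i>\<close> moves the first-order term in
    \<open>a \<bullet> x\<close> into the imaginary part.\<close>
  have z: "poly [:0, -\<i>:] (Complex (a \<bullet> x) (u \<bullet> x)) = Complex (u \<bullet> x) (- (a \<bullet> x))" for x
    by (simp add: complex_eq_iff)
  obtain A B where AB: "real_polynomial_function A" "real_polynomial_function B"
    "\<And>x. Complex (u \<bullet> x) (- (a \<bullet> x)) ^ k =
       Complex ((u \<bullet> x) ^ k + (a \<bullet> x)\<^sup>2 * A x) (- (real k * (a \<bullet> x) * (u \<bullet> x) ^ (k - 1)) + (a \<bullet> x)\<^sup>2 * B x)"
    using power_inner_mod_square by blast
  have "wave_span a (\<lambda>x. norm b ^ k * wave ([:0, -\<i>:] ^ k) a u x)"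
    using u by (intro wave_span.intros)
  moreover have "real_polynomial_function (\<lambda>x. norm b ^ k * A x)"
    by (intro real_polynomial_intros AB)
  moreover have "norm b ^ k * wave ([:0, -\<i>:] ^ k) a u x = (b \<bullet> x) ^ k + (a \<bullet> x)\<^sup>2 * (norm b ^ k * A x)" for x
    by (simp only: wave_def poly_power z AB(3) b) (simp add: algebra_simps)
  ultimately show "\<exists>v R. wave_span a v \<and> real_polynomial_function R \<and> (\<forall>x. v x = (b \<bullet> x) ^ k + (a \<bullet> x)\<^sup>2 * R x)"
    by blast
  \<comment> \<open>The imaginary part of the power \<open>Suc k\<close> starts with
    \<open>- real (Suc k) * (a \<bullet> x) * (u \<bullet> x) ^ k\<close>. The factor
    \<open>\<i>\<close> below reverses its sign, and \<open>?c\<close> removes \<open>Suc k\<close>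
    and turns \<open>u\<close> back into \<open>b\<close>.\<close>
  let ?c = "norm b ^ k / real (Suc k)"
  obtain A B where AB: "real_polynomial_function A" "real_polynomial_function B"
    "\<And>x. Complex (u \<bullet> x) (- (a \<bullet> x)) ^ Suc k =
       Complex ((u \<bullet> x) ^ Suc k + (a \<bullet> x)\<^sup>2 * A x) (- (real (Suc k) * (a \<bullet> x) * (u \<bullet> x) ^ (Suc k - 1)) + (a \<bullet> x)\<^sup>2 * B x)"
    using power_inner_mod_square by blast
  have "wave_span a (\<lambda>x. ?c * wave (smult \<i> ([:0, -\<i>:] ^ Suc k)) a u x)"
    using u by (intro wave_span.intros)
  moreover have "real_polynomial_function (\<lambda>x. (- ?c) * B x)"
    by (intro real_polynomial_intros AB)
  moreover have "?c * wave (smult \<i> ([:0, -\<i>:] ^ Suc k)) a u x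
      = (a \<bullet> x) * (b \<bullet> x) ^ k + (a \<bullet> x)\<^sup>2 * ((- ?c) * B x)" for x
    by (simp only: wave_def poly_power poly_smult z AB(3) b)
      (simp add: field_simps del: of_nat_Suc)
  ultimately show "\<exists>v R. wave_span a v \<and> real_polynomial_function R \<and> (\<forall>x. v x = (a \<bullet> x) * (b \<bullet> x) ^ k + (a \<bullet> x)\<^sup>2 * R x)"
    by blast
qed

section \<open>The Cauchy problem on the hyperplane orthogonal to \<open>a\<close>\<close>

definition hyperplane_proj :: "'a::euclidean_space \<Rightarrow> 'a \<Rightarrow> 'a" where
  "hyperplane_proj a x = x - (a \<bullet> x) *\<^sub>R a"

text \<open>The projection is self-adjoint, so composing it with a power of a linear form gives such
  a power again, now with direction orthogonal to \<open>a\<close>. The rest is linearity.\<close>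

lemma wave_span_cauchy_data_polynomial:
  fixes P :: "real ^ 'n \<Rightarrow> real"
  assumes "CARD('n) \<ge> 2" "norm a = 1" "real_polynomial_function P"
  shows "\<exists>v R. wave_span a v \<and> real_polynomial_function R \<and> (\<forall>x. v x = P (hyperplane_proj a x) + (a \<bullet> x)\<^sup>2 * R x)"
    and "\<exists>v R. wave_span a v \<and> real_polynomial_function R \<and>
      (\<forall>x. v x = (a \<bullet> x) * P (hyperplane_proj a x) + (a \<bullet> x)\<^sup>2 * R x)"
proof -
  have hp: "c \<bullet> hyperplane_proj a x = hyperplane_proj a c \<bullet> x" for c x
    by (simp add: hyperplane_proj_def inner_diff_right inner_diff_left inner_commute)
  have orth: "a \<bullet> hyperplane_proj a c = 0" for c
    using assms(2) by (simp add: hyperplane_proj_def inner_diff_right norm_eq_1)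
  note P = ridge_span_real_polynomial_function[OF assms(3)]
  show "\<exists>v R. wave_span a v \<and> real_polynomial_function R \<and> (\<forall>x. v x = P (hyperplane_proj a x) + (a \<bullet> x)\<^sup>2 * R x)"
    using P
  proof induction
    case (ridge c k)
    show ?case unfolding hp by (rule wave_span_cauchy_data(1)[OF assms(1,2) orth])
  next
    case (add f g)
    obtain v R where v: "wave_span a v" "real_polynomial_function R"
      "\<And>x. v x = f (hyperplane_proj a x) + (a \<bullet> x)\<^sup>2 * R x" using add.IH(1) by metis
    obtain w S where w: "wave_span a w" "real_polynomial_function S"
      "\<And>x. w x = g (hyperplane_proj a x) + (a \<bullet> x)\<^sup>2 * S x" using add.IH(2) by metis
    have "v x + w x = (f (hyperplane_proj a x) + g (hyperplane_proj a x)) + (a \<bullet> x)\<^sup>2 * (R x + S x)" for x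
      unfolding v(3) w(3) by (simp add: algebra_simps)
    then show ?case
      using wave_span.add[OF v(1) w(1)] real_polynomial_function.intros(3)[OF v(2) w(2)] by blast
  next
    case (scale f c)
    obtain v R where v: "wave_span a v" "real_polynomial_function R"
      "\<And>x. v x = f (hyperplane_proj a x) + (a \<bullet> x)\<^sup>2 * R x" using scale.IH by metis
    have "c * v x = (c * f (hyperplane_proj a x)) + (a \<bullet> x)\<^sup>2 * (c * R x)" for x
      unfolding v(3) by (simp add: algebra_simps)
    show ?case
    proof (intro exI conjI allI)
      show "wave_span a (\<lambda>x. c * v x)" by (rule wave_span.scale[OF v(1)])
      show "real_polynomial_function (\<lambda>x. c * R x)"
        by (rule real_polynomial_function.intros(4)[OF real_polynomial_function.intros(2) v(2)])
    qed fact
  qed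
  show "\<exists>v R. wave_span a v \<and> real_polynomial_function R \<and>
      (\<forall>x. v x = (a \<bullet> x) * P (hyperplane_proj a x) + (a \<bullet> x)\<^sup>2 * R x)"
    using P
  proof induction
    case (ridge c k)
    show ?case unfolding hp by (rule wave_span_cauchy_data(2)[OF assms(1,2) orth])
  next
    case (add f g)
    obtain v R where v: "wave_span a v" "real_polynomial_function R"
      "\<And>x. v x = (a \<bullet> x) * f (hyperplane_proj a x) + (a \<bullet> x)\<^sup>2 * R x" using add.IH(1) by metis
    obtain w S where w: "wave_span a w" "real_polynomial_function S"
      "\<And>x. w x = (a \<bullet> x) * g (hyperplane_proj a x) + (a \<bullet> x)\<^sup>2 * S x" using add.IH(2) by metis
    have "v x + w x = (a \<bullet> x) * (f (hyperplane_proj a x) + g (hyperplane_proj a x)) + (a \<bullet> x)\<^sup>2 * (R x + S x)" for x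
      unfolding v(3) w(3) by (simp add: algebra_simps)
    then show ?case
      using wave_span.add[OF v(1) w(1)] real_polynomial_function.intros(3)[OF v(2) w(2)] by blast
  next
    case (scale f c)
    obtain v R where v: "wave_span a v" "real_polynomial_function R"
      "\<And>x. v x = (a \<bullet> x) * f (hyperplane_proj a x) + (a \<bullet> x)\<^sup>2 * R x" using scale.IH by metis
    have "c * v x = (a \<bullet> x) * (c * f (hyperplane_proj a x)) + (a \<bullet> x)\<^sup>2 * (c * R x)" for x
      unfolding v(3) by (simp add: algebra_simps)
    show ?case
    proof (intro exI conjI allI)
      show "wave_span a (\<lambda>x. c * v x)" by (rule wave_span.scale[OF v(1)])
      show "real_polynomial_function (\<lambda>x. c * R x)"
        by (rule real_polynomial_function.intros(4)[OF real_polynomial_function.intros(2) v(2)])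
    qed fact
  qed
qed

text \<open>The arguments \<open>x\<close> and \<open>hyperplane_proj a x\<close> differ by
  \<open>(a \<bullet> x) *\<^sub>R a\<close>. Applied twice, this expands a polynomial to second
  order in \<open>a \<bullet> x\<close>.\<close>

lemma real_polynomial_function_split_hyperplane:
  fixes P :: "'a::euclidean_space \<Rightarrow> real"
  assumes "real_polynomial_function P"
  shows "\<exists>Q. real_polynomial_function Q \<and> (\<forall>x. P x = P (hyperplane_proj a x) + (a \<bullet> x) * Q x)"
  using assms
proof induction
  case (linear f)
  then interpret bounded_linear f .
  show ?case
    by (intro exI[of _ "\<lambda>x. f a"]) (auto simp: hyperplane_proj_def diff scaleR)
next
  case (const c)
  show ?case by (intro exI[of _ "\<lambda>x. 0"]) auto
next
  case (add f g)
  obtain F where F: "real_polynomial_function F" "\<And>x. f x = f (hyperplane_proj a x) + (a \<bullet> x) * F x"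
    using add.IH(1) by (elim exE conjE) (rule that, assumption, erule spec)
  obtain G where G: "real_polynomial_function G" "\<And>x. g x = g (hyperplane_proj a x) + (a \<bullet> x) * G x"
    using add.IH(2) by (elim exE conjE) (rule that, assumption, erule spec)
  have "f x + g x = f (hyperplane_proj a x) + g (hyperplane_proj a x) + (a \<bullet> x) * (F x + G x)" for x
    using F(2)[of x] G(2)[of x] by algebra
  then show ?case
    using F(1) G(1) by blast
next
  case (mult f g)
  obtain F where F: "real_polynomial_function F" "\<And>x. f x = f (hyperplane_proj a x) + (a \<bullet> x) * F x"
    using mult.IH(1) by (elim exE conjE) (rule that, assumption, erule spec)
  obtain G where G: "real_polynomial_function G" "\<And>x. g x = g (hyperplane_proj a x) + (a \<bullet> x) * G x"
    using mult.IH(2) by (elim exE conjE) (rule that, assumption, erule spec)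
  \<comment> \<open>With \<open>f0\<close>, \<open>g0\<close> the values at the projected point, the
    difference of the products is \<open>f0 * (g - g0) + (f - f0) * g\<close>; here
    \<open>f0\<close> is written as \<open>f - (a \<bullet> x) * F\<close>.\<close>
  have "real_polynomial_function (\<lambda>x. (f x + (-1) * ((a \<bullet> x) * F x)) * G x + F x * g x)"
    by (intro real_polynomial_intros F G mult.hyps)
  moreover have "f x * g x = f (hyperplane_proj a x) * g (hyperplane_proj a x)
      + (a \<bullet> x) * ((f x + (-1) * ((a \<bullet> x) * F x)) * G x + F x * g x)" for x
    using F(2)[of x] G(2)[of x] by algebra
  ultimately show ?case by blast
qed

text \<open>For \<open>D = s ^ k * q\<close> with \<open>s = a \<bullet> x\<close>, the only term of
  the Laplacian of order \<open>s ^ (k - 2)\<close> is \<open>k * (k - 1) * s ^ (k - 2) * q\<close>.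
  Since the Laplacian is 0 and \<open>k \<ge> 2\<close>, \<open>q\<close> must contain another
  factor \<open>s\<close>.\<close>

lemma harmonic_zero_cauchy_data_step:
  fixes D :: "real ^ 'n \<Rightarrow> real"
  assumes "D \<in> harmonic_polynomials" "norm a = 1"
    and q: "real_polynomial_function q" "\<And>x. D x = (a \<bullet> x) ^ Suc (Suc j) * q x"
  shows "\<exists>r. real_polynomial_function r \<and> (\<forall>x. D x = (a \<bullet> x) ^ Suc (Suc (Suc j)) * r x)"
proof -
  define k where "k = Suc (Suc j)"
  \<comment> \<open>The derivative of \<open>q\<close> in direction \<open>a\<close>.\<close>
  define G where "G x = (\<Sum>i\<in>UNIV. a $ i * partial_deriv i q x)" for x
  have poly: "real_polynomial_function (laplacian q)" "real_polynomial_function G"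
    unfolding G_def using q(1) by (auto intro!: real_polynomial_function_sum)
  define r where "r x = (- 1 / (real k * real (k - 1))) * ((a \<bullet> x) * laplacian q x + 2 * real k * G x)" for x
  have "real_polynomial_function r"
    unfolding r_def by (intro real_polynomial_intros poly)
  moreover have "D x = (a \<bullet> x) ^ Suc k * r x" for x
  \<comment> \<open>The power of \<open>a \<bullet> x\<close> can be cancelled only off the
    hyperplane; on it both sides vanish.\<close>
  proof (cases "a \<bullet> x = 0")
    case True
    then show ?thesis by (simp add: q(2))
  next
    case False
    have "D = (\<lambda>x. (a \<bullet> x) ^ k * q x)" by (simp add: q(2) k_def fun_eq_iff)
    with assms(1) have "0 = laplacian (\<lambda>x. (a \<bullet> x) ^ k * q x) x"
      by (simp add: harmonic_polynomials_def)
    also have "\<dots> = (a \<bullet> x) ^ k * laplacian q x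
        + 2 * (\<Sum>i\<in>UNIV. (real k * (a \<bullet> x) ^ (k - 1)) * (a $ i * partial_deriv i q x))
        + real k * real (k - 1) * (a \<bullet> a) * (a \<bullet> x) ^ (k - 2) * q x"
      using q(1)
      by (subst laplacian_mult)
        (auto simp: laplacian_inner_power partial_deriv_power real_polynomial_function_inner
          partial_deriv_inner mult_ac)
    also have "\<dots> = (a \<bullet> x) ^ j * ((a \<bullet> x) * ((a \<bullet> x) * laplacian q x + 2 * real k * G x) + real k * real (k - 1) * q x)"
      using assms(2) unfolding G_def sum_distrib_left[symmetric]
      by (simp add: norm_eq_1 k_def algebra_simps)
    finally have "real k * real (k - 1) * q x = - ((a \<bullet> x) * ((a \<bullet> x) * laplacian q x + 2 * real k * G x))"
      using False by simp
    moreover have "real k * real (k - 1) \<noteq> 0" by (simp add: k_def)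
    ultimately have "q x = (a \<bullet> x) * r x"
      unfolding r_def by (simp add: field_simps)
    then show ?thesis by (simp add: q(2) k_def)
  qed
  ultimately show ?thesis unfolding k_def by blast
qed

text \<open>On the line through \<open>x\<close> in direction \<open>a\<close>, \<open>D\<close>
  becomes a polynomial \<open>p\<close> in the single variable \<open>t = a \<bullet> x\<close>. It
  is divisible by a power of \<open>t\<close> exceeding its degree, hence 0.\<close>

lemma real_polynomial_function_zero_of_high_order:
  fixes D :: "'a::euclidean_space \<Rightarrow> real"
  assumes D: "real_polynomial_function D" and a: "norm a = 1"
    and high: "\<And>k. \<exists>q. real_polynomial_function q \<and> (\<forall>x. D x = (a \<bullet> x) ^ k * q x)"
  shows "D x = 0"
proof -
  define l where "l t = hyperplane_proj a x + t *\<^sub>R a" for t :: real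
  have al: "a \<bullet> l t = t" for t
    using a by (simp add: l_def hyperplane_proj_def inner_add_right inner_diff_right norm_eq_1)
  have "\<exists>p. \<forall>t. f (l t) = poly p t" if "real_polynomial_function f" for f
    using that
  proof induction
    case (linear f)
    then interpret bounded_linear f .
    show ?case by (intro exI[of _ "[:f (hyperplane_proj a x), f a:]"]) (simp add: l_def add scaleR)
  next
    case (const c)
    show ?case by (intro exI[of _ "[:c:]"]) simp
  next
    case (add f g)
    then show ?case by (metis poly_add)
  next
    case (mult f g)
    then show ?case by (metis poly_mult)
  qed
  note line = this
  obtain p where p: "\<And>t. D (l t) = poly p t" using line[OF D] by blast
  obtain q where q: "real_polynomial_function q" "\<And>x. D x = (a \<bullet> x) ^ Suc (degree p) * q x"
    using high by blast
  obtain r where r: "\<And>t. q (l t) = poly r t" using line[OF q(1)] by blast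
  have "poly p t = poly (monom 1 (Suc (degree p)) * r) t" for t
    using p[of t] q(2)[of "l t"] by (simp add: al r poly_monom)
  then have p_eq: "p = monom 1 (Suc (degree p)) * r"
    by (simp add: poly_eq_poly_eq_iff[symmetric] fun_eq_iff)
  have "r = 0"
  proof (rule ccontr)
    assume "r \<noteq> 0"
    then have "degree (monom 1 (Suc (degree p)) * r) = Suc (degree p) + degree r"
      by (subst degree_mult_eq) (auto simp: degree_monom_eq)
    with p_eq show False by simp
  qed
  then have "p = 0" using p_eq by simp
  moreover have "l (a \<bullet> x) = x" by (simp add: l_def hyperplane_proj_def)
  ultimately show ?thesis using p[of "a \<bullet> x"] by simp
qed

text \<open>Uniqueness for the Cauchy problem: modulo \<open>(a \<bullet> x)\<^sup>2\<close>,
  \<open>H\<close> is determined by the restrictions of \<open>H\<close> and \<open>Q\<close> to the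
  hyperplane, and \<open>v + w\<close> matches both. The harmonic difference \<open>D\<close> is
  then divisible by every power of \<open>a \<bullet> x\<close>, so it vanishes.\<close>

lemma harmonic_wave_span:
  fixes H :: "real ^ 'n \<Rightarrow> real"
  assumes "CARD('n) \<ge> 2" "norm a = 1" and H: "H \<in> harmonic_polynomials"
  shows "wave_span a H"
proof -
  note HP = harmonic_polynomials_real_polynomial_function
  obtain Q where Q: "real_polynomial_function Q" "\<And>x. H x = H (hyperplane_proj a x) + (a \<bullet> x) * Q x"
    using real_polynomial_function_split_hyperplane[OF HP[OF H]] by blast
  obtain S where S: "real_polynomial_function S" "\<And>x. Q x = Q (hyperplane_proj a x) + (a \<bullet> x) * S x"
    using real_polynomial_function_split_hyperplane[OF Q(1)] by blast
  obtain v R where v: "wave_span a v" "real_polynomial_function R" "\<And>x. v x = H (hyperplane_proj a x) + (a \<bullet> x)\<^sup>2 * R x"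
    using wave_span_cauchy_data_polynomial(1)[OF assms(1,2) HP[OF H]] by blast
  obtain w T where w: "wave_span a w" "real_polynomial_function T"
    "\<And>x. w x = (a \<bullet> x) * Q (hyperplane_proj a x) + (a \<bullet> x)\<^sup>2 * T x"
    using wave_span_cauchy_data_polynomial(2)[OF assms(1,2) Q(1)] by blast
  have vw: "wave_span a (\<lambda>x. v x + w x)" using v w by (intro wave_span.add)
  define D where "D x = H x + (-1) * (v x + w x)" for x
  have D: "D \<in> harmonic_polynomials"
    unfolding D_def
    by (intro harmonic_polynomials_add harmonic_polynomials_scale[OF wave_span_harmonic[OF vw assms(2)]] H)
  have "\<exists>q. real_polynomial_function q \<and> (\<forall>x. D x = (a \<bullet> x) ^ Suc (Suc j) * q x)" for j
  proof (induction j)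
    case 0
    have "real_polynomial_function (\<lambda>x. S x + (-1) * (R x + T x))"
      by (intro real_polynomial_intros S v w)
    moreover have "D x = (a \<bullet> x) ^ Suc (Suc 0) * (S x + (-1) * (R x + T x))" for x
      unfolding D_def using Q(2)[of x] S(2)[of x] v(3)[of x] w(3)[of x]
      by (simp add: power2_eq_square algebra_simps)
    ultimately show ?case by blast
  next
    case (Suc j)
    then show ?case using harmonic_zero_cauchy_data_step[OF D assms(2)] by blast
  qed
  note high = this
  have "\<exists>q. real_polynomial_function q \<and> (\<forall>x. D x = (a \<bullet> x) ^ k * q x)" for k
  proof -
    obtain q where "real_polynomial_function q" "\<forall>x. D x = (a \<bullet> x) ^ Suc (Suc k) * q x"
      using high by blast
    moreover from this have "real_polynomial_function (\<lambda>x. (a \<bullet> x)\<^sup>2 * q x)"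
      by (intro real_polynomial_intros) auto
    ultimately show ?thesis
      by (intro exI[of _ "\<lambda>x. (a \<bullet> x)\<^sup>2 * q x"]) (simp add: power2_eq_square mult_ac)
  qed
  from real_polynomial_function_zero_of_high_order[OF HP[OF D] assms(2) this]
  have "H x = v x + w x" for x by (simp add: D_def algebra_simps)
  then have "H = (\<lambda>x. v x + w x)" by blast
  with vw show ?thesis by simp
qed

section \<open>Damping plane waves at a point\<close>

text \<open>\<open>(1 + z) / 2\<close> maps the closed unit disc into itself and has modulus 1 only
  at \<open>z = 1\<close>. Its powers tend to 0 at the other points of the disc but stay 1 at
  \<open>z = 1\<close>.\<close>

definition notch_factor :: "nat \<Rightarrow> nat \<Rightarrow> complex poly" where
  "notch_factor m N = (1 - [:1/2, 1/2:] ^ N) ^ Suc m"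

lemma power_dvd_notch_factor: "[:-1, 1:] ^ Suc m dvd notch_factor m N"
  unfolding notch_factor_def
  by (intro dvd_power_same) (simp add: poly_eq_0_iff_dvd[symmetric])

lemma norm_notch_factor_le:
  assumes "norm z \<le> 1"
  shows "norm (poly (notch_factor m N) z) \<le> 2 ^ Suc m"
proof -
  have "norm (poly [:1/2, 1/2:] z) \<le> 1"
    using assms norm_triangle_ineq[of "1/2" "z * (1/2)"] by (simp add: norm_mult norm_divide)
  then have "norm (poly [:1/2, 1/2:] z ^ N) \<le> 1"
    unfolding norm_power by (intro power_le_one) auto
  then have "norm (1 - poly [:1/2, 1/2:] z ^ N) \<le> 2"
    using norm_triangle_ineq4[of 1 "poly [:1/2, 1/2:] z ^ N"] by simp
  then show ?thesis
    unfolding notch_factor_def poly_power poly_diff norm_power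
    by (intro power_mono) auto
qed

lemma tendsto_notch_factor:
  assumes "norm z \<le> 1" "Re z < 1"
  shows "(\<lambda>N. poly (notch_factor m N) z) \<longlonglongrightarrow> 1"
proof -
  have "(norm (1 + z))\<^sup>2 = 1 + 2 * Re z + (norm z)\<^sup>2"
    unfolding cmod_power2 by (simp add: power2_eq_square algebra_simps)
  also have "\<dots> < 2\<^sup>2"
    using assms power_le_one[of "norm z" 2] by simp
  finally have "norm (1 + z) < 2" by (rule power_less_imp_less_base) simp
  then have "norm (poly [:1/2, 1/2:] z) < 1"
    by (simp add: norm_divide add_divide_distrib[symmetric])
  then have "(\<lambda>N. (1 - poly [:1/2, 1/2:] z ^ N) ^ Suc m) \<longlonglongrightarrow> (1 - 0) ^ Suc m"
    by (intro tendsto_intros LIMSEQ_power_zero)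
  then show ?thesis by (simp add: notch_factor_def)
qed

text \<open>Bessel's inequality for the orthonormal pair \<open>a\<close>, \<open>b\<close>;
  \<open>y\<close> is the projection of \<open>x\<close> onto their span.\<close>

lemma norm_Complex_inner_le_1:
  assumes "norm a = 1" "norm b = 1" "a \<bullet> b = 0" "norm x = 1"
  shows "norm (Complex (a \<bullet> x) (b \<bullet> x)) \<le> 1"
proof -
  define y where "y = (a \<bullet> x) *\<^sub>R a + (b \<bullet> x) *\<^sub>R b"
  define r where "r = (a \<bullet> x)\<^sup>2 + (b \<bullet> x)\<^sup>2"
  have "y \<bullet> y = r"
    using assms(1-3)
    by (simp add: y_def r_def inner_add_left inner_add_right norm_eq_1 inner_commute[of b a] power2_eq_square)
  moreover have "y \<bullet> x = r"
    by (simp add: y_def r_def inner_add_left power2_eq_square)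
  moreover have "(y \<bullet> x)\<^sup>2 \<le> (y \<bullet> y) * (x \<bullet> x)" by (rule Cauchy_Schwarz_ineq)
  ultimately have "r * r \<le> r * 1"
    using assms(4) by (simp add: norm_eq_1 power2_eq_square)
  moreover have "0 \<le> r" by (simp add: r_def)
  ultimately have "r \<le> 1" by (cases "r = 0") auto
  then show ?thesis by (simp add: cmod_def r_def)
qed

text \<open>The bound is uniform in \<open>N\<close> and only one point is excepted, as dominated
  convergence requires. Both features survive linear combinations, so the notch factors are used for
  a single wave only.\<close>

lemma wave_span_limit_vanishing:
  assumes "wave_span a v" "norm a = 1"
  shows "\<exists>g B. (\<forall>N. g N \<in> harmonic_polys_vanishing m a)
    \<and> (\<forall>N. \<forall>x\<in>sphere 0 1. \<bar>g N x\<bar> \<le> B) \<and> (\<forall>x\<in>sphere 0 1 - {a}. (\<lambda>N. g N x) \<longlonglongrightarrow> v x)"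
  using assms(1)
proof induction
  case (wave b F)
  have "bounded (poly F ` cball 0 1)"
    by (intro compact_imp_bounded compact_continuous_image continuous_intros) auto
  then obtain C where "\<forall>z\<in>cball 0 1. norm (poly F z) \<le> C"
    by (auto simp: bounded_iff)
  then have C: "norm (poly F z) \<le> C" if "norm z \<le> 1" for z
    using that by simp
  let ?g = "\<lambda>N. wave (F * notch_factor m N) a b"
  have "?g N \<in> harmonic_polys_vanishing m a" for N
    using wave assms(2) by (intro wave_vanishing dvd_mult power_dvd_notch_factor)
  moreover have "\<bar>?g N x\<bar> \<le> C * 2 ^ Suc m" if "x \<in> sphere 0 1" for N x
  proof -
    let ?z = "Complex (a \<bullet> x) (b \<bullet> x)"
    have z: "norm ?z \<le> 1" by (rule norm_Complex_inner_le_1) (use that wave assms(2) in auto)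
    have "\<bar>?g N x\<bar> \<le> norm (poly F ?z) * norm (poly (notch_factor m N) ?z)"
      unfolding wave_def by (metis abs_Re_le_cmod norm_mult poly_mult)
    also have "\<dots> \<le> C * 2 ^ Suc m"
      using C[OF z] by (intro mult_mono norm_notch_factor_le z C) (auto intro: order_trans[OF norm_ge_zero])
    finally show ?thesis .
  qed
  moreover have "(\<lambda>N. ?g N x) \<longlonglongrightarrow> wave F a b x" if "x \<in> sphere 0 1 - {a}" for x
  proof -
    let ?z = "Complex (a \<bullet> x) (b \<bullet> x)"
    have z: "norm ?z \<le> 1" by (rule norm_Complex_inner_le_1) (use that wave assms(2) in auto)
    \<comment> \<open>A point of the sphere other than \<open>a\<close> satisfies
      \<open>a \<bullet> x < 1\<close>.\<close>
    have "0 < (a - x) \<bullet> (a - x)" using that by auto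
    also have "(a - x) \<bullet> (a - x) = 2 - 2 * (a \<bullet> x)"
      using that assms(2) by (simp add: inner_diff_left inner_diff_right inner_commute norm_eq_1)
    finally have "Re ?z < 1" by simp
    from tendsto_notch_factor[OF z this]
    have "(\<lambda>N. Re (poly F ?z * poly (notch_factor m N) ?z)) \<longlonglongrightarrow> Re (poly F ?z * 1)"
      by (intro tendsto_intros)
    then show ?thesis by (simp add: wave_def)
  qed
  ultimately show ?case by (intro exI[of _ ?g] exI[of _ "C * 2 ^ Suc m"]) blast
next
  case (add f h)
  obtain g B where g: "\<And>N. g N \<in> harmonic_polys_vanishing m a" "\<And>N x. x \<in> sphere 0 1 \<Longrightarrow> \<bar>g N x\<bar> \<le> B"
    "\<And>x. x \<in> sphere 0 1 - {a} \<Longrightarrow> (\<lambda>N. g N x) \<longlonglongrightarrow> f x" using add.IH(1) by blast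
  obtain g' B' where g': "\<And>N. g' N \<in> harmonic_polys_vanishing m a" "\<And>N x. x \<in> sphere 0 1 \<Longrightarrow> \<bar>g' N x\<bar> \<le> B'"
    "\<And>x. x \<in> sphere 0 1 - {a} \<Longrightarrow> (\<lambda>N. g' N x) \<longlonglongrightarrow> h x" using add.IH(2) by blast
  show ?case
    by (rule exI[of _ "\<lambda>N x. g N x + g' N x"], rule exI[of _ "B + B'"])
      (auto intro!: harmonic_polys_vanishing_add g g' tendsto_add order_trans[OF abs_triangle_ineq] add_mono)
next
  case (scale f c)
  obtain g B where g: "\<And>N. g N \<in> harmonic_polys_vanishing m a" "\<And>N x. x \<in> sphere 0 1 \<Longrightarrow> \<bar>g N x\<bar> \<le> B"
    "\<And>x. x \<in> sphere 0 1 - {a} \<Longrightarrow> (\<lambda>N. g N x) \<longlonglongrightarrow> f x" using scale.IH by blast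
  show ?case
    by (rule exI[of _ "\<lambda>N x. c * g N x"], rule exI[of _ "\<bar>c\<bar> * B"])
      (auto intro!: harmonic_polys_vanishing_scale g tendsto_mult mult_left_mono simp: abs_mult)
qed

section \<open>Density in \<open>L\<^sup>p\<close>\<close>

text \<open>A substitute for the triangle inequality covering \<open>p < 1\<close> as well; the
  constant comes from
  \<open>\<bar>a + b\<bar> \<le> 2 * max \<bar>a\<bar> \<bar>b\<bar>\<close>.\<close>

lemma abs_add_powr_le:
  fixes a b p :: real
  assumes "0 < p"
  shows "\<bar>a + b\<bar> powr p \<le> 2 powr p * (\<bar>a\<bar> powr p + \<bar>b\<bar> powr p)"
proof -
  have "\<bar>a + b\<bar> powr p \<le> (2 * max \<bar>a\<bar> \<bar>b\<bar>) powr p"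
    using assms by (intro powr_mono2) auto
  also have "\<dots> = 2 powr p * (max \<bar>a\<bar> \<bar>b\<bar>) powr p" by (simp add: powr_mult)
  also have "\<dots> \<le> 2 powr p * (\<bar>a\<bar> powr p + \<bar>b\<bar> powr p)"
    by (intro mult_left_mono) (auto simp: max_def)
  finally show ?thesis .
qed

lemma Lp_space_add:
  assumes "0 < p" "f \<in> Lp_space M p" "g \<in> Lp_space M p"
  shows "(\<lambda>x. f x + g x) \<in> Lp_space M p"
proof -
  have [measurable]: "f \<in> borel_measurable M" "g \<in> borel_measurable M"
    using assms by (auto simp: Lp_space_def)
  have "integrable M (\<lambda>x. 2 powr p * (\<bar>f x\<bar> powr p + \<bar>g x\<bar> powr p))"
    using assms by (auto simp: Lp_space_def)
  then have "integrable M (\<lambda>x. \<bar>f x + g x\<bar> powr p)"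
    by (rule Bochner_Integration.integrable_bound) (auto simp: abs_add_powr_le assms)
  then show ?thesis by (simp add: Lp_space_def)
qed

lemma Lp_space_scale:
  assumes "f \<in> Lp_space M p"
  shows "(\<lambda>x. c * f x) \<in> Lp_space M p"
  using assms by (auto simp: Lp_space_def abs_mult powr_mult)

lemma Lp_space_diff:
  assumes "0 < p" "f \<in> Lp_space M p" "g \<in> Lp_space M p"
  shows "(\<lambda>x. f x - g x) \<in> Lp_space M p"
  using Lp_space_add[OF assms(1,2) Lp_space_scale[OF assms(3), of "-1"]] by simp

lemma integral_abs_diff_powr_triangle:
  assumes "0 < p" "f \<in> Lp_space M p" "g \<in> Lp_space M p" "h \<in> Lp_space M p"
  shows "(\<integral>x. \<bar>f x - h x\<bar> powr p \<partial>M)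
    \<le> 2 powr p * ((\<integral>x. \<bar>f x - g x\<bar> powr p \<partial>M) + (\<integral>x. \<bar>g x - h x\<bar> powr p \<partial>M))"
proof -
  have i: "integrable M (\<lambda>x. \<bar>u x - v x\<bar> powr p)" if "u \<in> Lp_space M p" "v \<in> Lp_space M p" for u v
    using Lp_space_diff[OF assms(1) that] by (simp add: Lp_space_def)
  have "(\<integral>x. \<bar>f x - h x\<bar> powr p \<partial>M)
      \<le> (\<integral>x. 2 powr p * (\<bar>f x - g x\<bar> powr p + \<bar>g x - h x\<bar> powr p) \<partial>M)"
    using abs_add_powr_le[OF assms(1), of "f x - g x" "g x - h x" for x]
    by (intro integral_mono) (auto intro!: i assms)
  then show ?thesis using assms by (simp add: i)
qed

section \<open>Closure of a linear subspace of \<open>L^p\<close>\<close>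

definition Lp_closure :: "'a measure \<Rightarrow> real \<Rightarrow> ('a \<Rightarrow> real) set \<Rightarrow> ('a \<Rightarrow> real) set" where
  "Lp_closure M p S = {f \<in> Lp_space M p. \<forall>\<epsilon>>0. \<exists>g\<in>S. (\<integral>x. \<bar>f x - g x\<bar> powr p \<partial>M) < \<epsilon>}"

lemma Lp_closure_superset:
  assumes "S \<subseteq> Lp_space M p"
  shows "S \<subseteq> Lp_closure M p S"
  using assms by (force simp: Lp_closure_def)

lemma Lp_closure_cong:
  assumes f: "f \<in> Lp_closure M p S" and eq: "\<And>x. x \<in> space M \<Longrightarrow> g x = f x"
  shows "g \<in> Lp_closure M p S"
proof -
  have "(\<integral>x. \<bar>g x - h x\<bar> powr p \<partial>M) = (\<integral>x. \<bar>f x - h x\<bar> powr p \<partial>M)" for h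
    by (intro Bochner_Integration.integral_cong) (auto simp: eq)
  moreover have "g \<in> borel_measurable M \<longleftrightarrow> f \<in> borel_measurable M"
    by (intro measurable_cong eq)
  moreover have "integrable M (\<lambda>x. \<bar>g x\<bar> powr p) \<longleftrightarrow> integrable M (\<lambda>x. \<bar>f x\<bar> powr p)"
    by (intro Bochner_Integration.integrable_cong) (auto simp: eq)
  ultimately show ?thesis using f by (simp add: Lp_closure_def Lp_space_def)
qed

locale Lp_subspace =
  fixes M :: "'a measure" and p :: real and S :: "('a \<Rightarrow> real) set"
  assumes p: "0 < p"
    and S: "S \<subseteq> Lp_space M p"
    and add: "f \<in> S \<Longrightarrow> g \<in> S \<Longrightarrow> (\<lambda>x. f x + g x) \<in> S"
    and scale: "f \<in> S \<Longrightarrow> (\<lambda>x. c * f x) \<in> S"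
begin

lemma Lp_closure_limit:
  assumes f: "f \<in> Lp_space M p"
    and s: "\<And>k::nat. s k \<in> Lp_closure M p S"
    and lim: "(\<lambda>k. \<integral>x. \<bar>f x - s k x\<bar> powr p \<partial>M) \<longlonglongrightarrow> 0"
  shows "f \<in> Lp_closure M p S"
proof -
  have "\<exists>g\<in>S. (\<integral>x. \<bar>f x - g x\<bar> powr p \<partial>M) < \<epsilon>" if "\<epsilon> > 0" for \<epsilon>
  proof -
    \<comment> \<open>Two errors below \<open>?d\<close>, multiplied by the constant
      \<open>2 powr p\<close> of the quasi-triangle inequality, add up to less than
      \<open>\<epsilon>\<close>.\<close>
    let ?d = "\<epsilon> / (2 * 2 powr p)"
    have d: "?d > 0" using that by simp
    from order_tendstoD(2)[OF lim d] obtain k where k: "(\<integral>x. \<bar>f x - s k x\<bar> powr p \<partial>M) < ?d"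
      by (auto simp: eventually_sequentially)
    from s[of k] d obtain g where g: "g \<in> S" "(\<integral>x. \<bar>s k x - g x\<bar> powr p \<partial>M) < ?d"
      unfolding Lp_closure_def by blast
    have "(\<integral>x. \<bar>f x - g x\<bar> powr p \<partial>M)
      \<le> 2 powr p * ((\<integral>x. \<bar>f x - s k x\<bar> powr p \<partial>M) + (\<integral>x. \<bar>s k x - g x\<bar> powr p \<partial>M))"
      using s[of k] g(1) S by (intro integral_abs_diff_powr_triangle p f) (auto simp: Lp_closure_def)
    also have "\<dots> < 2 powr p * (?d + ?d)"
      using k g(2) by (intro mult_strict_left_mono add_strict_mono) auto
    also have "\<dots> = \<epsilon>" by simp
    finally show ?thesis using g(1) by blast
  qed
  with f show ?thesis by (simp add: Lp_closure_def)
qed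

text \<open>The common tool of all later approximations. The bound passes to the limit
  \<open>f\<close>, so \<open>2 powr p * (w x powr p + w x powr p)\<close> dominates the integrands
  of the distances.\<close>

lemma Lp_closure_dominated:
  assumes f [measurable]: "f \<in> borel_measurable M"
    and s: "\<And>k::nat. s k \<in> Lp_closure M p S"
    and w: "integrable M (\<lambda>x. w x powr p)"
    and bound: "\<And>k x. x \<in> space M \<Longrightarrow> \<bar>s k x\<bar> \<le> w x"
    and lim: "AE x in M. (\<lambda>k. s k x) \<longlonglongrightarrow> f x"
  shows "f \<in> Lp_closure M p S"
proof -
  have [measurable]: "s k \<in> borel_measurable M" for k
    using s[of k] by (simp add: Lp_closure_def Lp_space_def)
  have AE_bound: "AE x in M. \<bar>f x\<bar> \<le> w x"
    using lim AE_space
  proof eventually_elim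
    case (elim x)
    from elim(1) have "(\<lambda>k. \<bar>s k x\<bar>) \<longlonglongrightarrow> \<bar>f x\<bar>" by (rule tendsto_rabs)
    then show ?case using bound[OF elim(2)] by (intro LIMSEQ_le_const2) auto
  qed
  have "integrable M (\<lambda>x. \<bar>f x\<bar> powr p)"
    by (rule Bochner_Integration.integrable_bound[OF w])
      (use AE_bound p in \<open>auto elim!: eventually_mono intro: powr_mono2\<close>)
  then have fL: "f \<in> Lp_space M p" by (simp add: Lp_space_def)
  have "(\<lambda>k. \<integral>x. \<bar>f x - s k x\<bar> powr p \<partial>M) \<longlonglongrightarrow> (\<integral>x. 0 \<partial>M)"
  proof (rule integral_dominated_convergence)
    show "integrable M (\<lambda>x. 2 powr p * (w x powr p + w x powr p))"
      using w by auto
    show "AE x in M. (\<lambda>k. \<bar>f x - s k x\<bar> powr p) \<longlonglongrightarrow> 0"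
      using lim
    proof eventually_elim
      case (elim x)
      then have "(\<lambda>k. \<bar>f x - s k x\<bar>) \<longlonglongrightarrow> \<bar>f x - f x\<bar>" by (intro tendsto_intros)
      then have "(\<lambda>k. \<bar>f x - s k x\<bar>) \<longlonglongrightarrow> 0" by simp
      from tendsto_powr'[OF this tendsto_const, of p] show ?case using p by simp
    qed
    show "AE x in M. norm (\<bar>f x - s k x\<bar> powr p) \<le> 2 powr p * (w x powr p + w x powr p)" for k
      using AE_bound AE_space
    proof eventually_elim
      case (elim x)
      have "\<bar>f x + - s k x\<bar> powr p \<le> 2 powr p * (\<bar>f x\<bar> powr p + \<bar>- s k x\<bar> powr p)"
        by (rule abs_add_powr_le[OF p])
      also have "\<dots> \<le> 2 powr p * (w x powr p + w x powr p)"
        using elim bound p by (intro mult_left_mono add_mono powr_mono2) auto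
      finally show ?case by simp
    qed
  qed auto
  then show ?thesis
    by (intro Lp_closure_limit[OF fL s]) simp
qed

lemma Lp_closure_add:
  assumes f: "f \<in> Lp_closure M p S" and g: "g \<in> Lp_closure M p S"
  shows "(\<lambda>x. f x + g x) \<in> Lp_closure M p S"
proof -
  have "\<exists>h\<in>S. (\<integral>x. \<bar>(f x + g x) - h x\<bar> powr p \<partial>M) < \<epsilon>" if "\<epsilon> > 0" for \<epsilon>
  proof -
    let ?d = "\<epsilon> / (2 * 2 powr p)"
    have d: "?d > 0" using that by simp
    obtain u v where uv: "u \<in> S" "v \<in> S" "(\<integral>x. \<bar>f x - u x\<bar> powr p \<partial>M) < ?d" "(\<integral>x. \<bar>g x - v x\<bar> powr p \<partial>M) < ?d"
      using f g d unfolding Lp_closure_def by blast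
    have L: "f \<in> Lp_space M p" "g \<in> Lp_space M p" "u \<in> Lp_space M p" "v \<in> Lp_space M p"
      using f g uv S by (auto simp: Lp_closure_def)
    have "(\<integral>x. \<bar>(f x + g x) - (u x + v x)\<bar> powr p \<partial>M)
      \<le> 2 powr p * ((\<integral>x. \<bar>(f x + g x) - (u x + g x)\<bar> powr p \<partial>M) + (\<integral>x. \<bar>(u x + g x) - (u x + v x)\<bar> powr p \<partial>M))"
      by (intro integral_abs_diff_powr_triangle p Lp_space_add L)
    also have "\<dots> < 2 powr p * (?d + ?d)"
      using uv(3,4) by (intro mult_strict_left_mono add_strict_mono) auto
    also have "\<dots> = \<epsilon>" by simp
    finally show ?thesis using add[OF uv(1,2)] by (intro bexI)
  qed
  then show ?thesis using f g by (auto simp: Lp_closure_def Lp_space_add p)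
qed

lemma Lp_closure_scale:
  assumes f: "f \<in> Lp_closure M p S"
  shows "(\<lambda>x. c * f x) \<in> Lp_closure M p S"
proof -
  have "\<exists>h\<in>S. (\<integral>x. \<bar>c * f x - h x\<bar> powr p \<partial>M) < \<epsilon>" if "\<epsilon> > 0" for \<epsilon>
  proof -
    \<comment> \<open>The summand 1 keeps the denominator positive for \<open>c = 0\<close> and
      makes the final estimate strict.\<close>
    let ?d = "\<epsilon> / (\<bar>c\<bar> powr p + 1)"
    have pos: "\<bar>c\<bar> powr p + 1 > 0" by (smt (verit) powr_ge_zero)
    then have d: "?d > 0" using that by simp
    obtain u where u: "u \<in> S" "(\<integral>x. \<bar>f x - u x\<bar> powr p \<partial>M) < ?d"
      using f d unfolding Lp_closure_def by blast
    have "(\<integral>x. \<bar>c * f x - c * u x\<bar> powr p \<partial>M) = \<bar>c\<bar> powr p * (\<integral>x. \<bar>f x - u x\<bar> powr p \<partial>M)"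
      by (simp add: right_diff_distrib[symmetric] abs_mult powr_mult del: right_diff_distrib)
    also have "\<dots> \<le> \<bar>c\<bar> powr p * ?d"
      using u(2) by (intro mult_left_mono) auto
    also have "\<dots> < \<epsilon>" using that pos by (simp add: field_simps)
    finally show ?thesis using scale[OF u(1)] by (intro bexI)
  qed
  then show ?thesis using f by (auto simp: Lp_closure_def Lp_space_scale)
qed

text \<open>A measurable \<open>f\<close> is a pointwise limit of simple functions bounded by
  \<open>2 * \<bar>f x\<bar>\<close>, and a simple function is a finite combination of indicators of
  its level sets.\<close>

lemma Lp_closure_eq_Lp_space:
  assumes ind: "\<And>A. A \<in> sets M \<Longrightarrow> indicator A \<in> Lp_closure M p S"
  shows "Lp_closure M p S = Lp_space M p"
proof
  show "Lp_space M p \<subseteq> Lp_closure M p S"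
  proof
    fix f assume f: "f \<in> Lp_space M p"
    then have [measurable]: "f \<in> borel_measurable M" by (simp add: Lp_space_def)
    obtain s where s: "\<And>i. simple_function M (s i)" "\<And>x. x \<in> space M \<Longrightarrow> (\<lambda>i. s i x) \<longlonglongrightarrow> f x"
      "\<And>i x. x \<in> space M \<Longrightarrow> dist (s i x) 0 \<le> 2 * dist (f x) 0"
      using borel_measurable_implies_sequence_metric[of f M 0] \<open>f \<in> borel_measurable M\<close> by blast
    have simple: "s i \<in> Lp_closure M p S" for i
    proof -
      have "(\<lambda>x. \<Sum>y\<in>Y. y * indicator (s i -` {y} \<inter> space M) x) \<in> Lp_closure M p S"
        if "finite Y" for Y
        using that
      proof induction
        case empty
        then show ?case
          using Lp_closure_scale[OF ind[OF sets.empty_sets], of 0] by simp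
      next
        case (insert y Y)
        have level: "s i -` {y} \<inter> space M \<in> sets M" using s(1) by (rule simple_functionD)
        show ?case
          using Lp_closure_add[OF Lp_closure_scale[OF ind[OF level], of y] insert.IH]
          by (simp only: sum.insert[OF insert.hyps])
      qed
      then have "(\<lambda>x. \<Sum>y\<in>s i ` space M. y * indicator (s i -` {y} \<inter> space M) x) \<in> Lp_closure M p S"
        using s(1) by (simp add: simple_function_def)
      then show ?thesis
      proof (rule Lp_closure_cong)
        fix x assume "x \<in> space M"
        then show "s i x = (\<Sum>y\<in>s i ` space M. y * indicator (s i -` {y} \<inter> space M) x)"
          using s(1)[of i] by (subst sum.remove[of _ "s i x"])
            (auto simp: simple_function_def indicator_def intro!: sum.neutral)
      qed
    qed
    show "f \<in> Lp_closure M p S"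
    proof (rule Lp_closure_dominated[OF _ simple])
      show "integrable M (\<lambda>x. (2 * \<bar>f x\<bar>) powr p)"
        using f by (simp add: Lp_space_def powr_mult)
      show "\<bar>s k x\<bar> \<le> 2 * \<bar>f x\<bar>" if "x \<in> space M" for k x
        using s(3)[OF that, of k] by simp
    qed (auto intro: s(2))
  qed
qed (auto simp: Lp_closure_def)

end

section \<open>The surface measure of the sphere\<close>

lemma finite_measure_sphere_measure: "finite_measure (sphere_measure :: 'a::euclidean_space measure)"
proof
  have "emeasure (sphere_measure :: 'a measure) (space sphere_measure)
      = of_nat DIM('a) * emeasure lborel {t *\<^sub>R x | t x. 0 < t \<and> t < 1 \<and> x \<in> sphere (0::'a) 1}"
    unfolding space_sphere_measure by (intro emeasure_sphere_measure) auto
  also have "\<dots> \<le> of_nat DIM('a) * emeasure lborel (ball (0::'a) 1)"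
    by (intro mult_left_mono emeasure_mono) auto
  also have "\<dots> < \<infinity>"
    using emeasure_lborel_ball_finite[of "0::'a" 1]
    by (simp add: ennreal_mult_less_top of_nat_less_top)
  finally show "emeasure (sphere_measure :: 'a measure) (space sphere_measure) \<noteq> \<infinity>" by simp
qed

text \<open>The cone over a point lies on a line, which is a null set from dimension 2 on. In
  dimension 1 the two points of the sphere have positive measure.\<close>

lemma AE_sphere_measure_neq:
  fixes a :: "'a::euclidean_space"
  assumes "DIM('a) \<ge> 2" "norm a = 1"
  shows "AE x in sphere_measure. x \<noteq> a"
proof (rule AE_I)
  have "{t *\<^sub>R x | t x. 0 < t \<and> t < 1 \<and> x \<in> {a}} \<subseteq> span {a}"
    by (auto intro: span_scale span_base)
  moreover have "negligible (span {a})"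
    using assms(1) dim_span[of "{a}"] dim_le_card[of "{a}" "{a}"] by (intro negligible_lowdim) auto
  ultimately have neg: "negligible {t *\<^sub>R x | t x. 0 < t \<and> t < 1 \<and> x \<in> {a}}"
    by (rule negligible_subset[rotated])
  \<comment> \<open>The cone is a Borel set, so negligibility carries over to
    \<open>lborel\<close>.\<close>
  have "{t *\<^sub>R x | t x. 0 < t \<and> t < 1 \<and> x \<in> {a}} = open_segment 0 a"
    using assms(2) by (auto simp: in_segment)
  then have "{t *\<^sub>R x | t x. 0 < t \<and> t < 1 \<and> x \<in> {a}} \<in> sets borel"
    by (simp add: open_segment_def sets.Diff)
  with neg have "emeasure lborel {t *\<^sub>R x | t x. 0 < t \<and> t < 1 \<and> x \<in> {a}} = 0"
    by (simp add: negligible_iff_emeasure0)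
  then show "emeasure sphere_measure {a} = 0"
    using assms(2) by (subst emeasure_sphere_measure) auto
  show "{a} \<in> sets sphere_measure"
    using assms(2) by (auto simp: sets_sphere_measure sets_restrict_space intro!: image_eqI[of _ _ "{a}"])
qed auto

text \<open>Off \<open>C\<close> the distance is positive and the terms are eventually 0. The case
  \<open>C = {}\<close> is excluded because \<open>infdist x {} = 0\<close>.\<close>

lemma indicator_closed_limit:
  fixes C :: "'a::euclidean_space set"
  assumes "closed C" "C \<noteq> {}"
  shows "(\<lambda>k. max 0 (1 - real k * infdist x C)) \<longlonglongrightarrow> indicator C x"
proof (cases "x \<in> C")
  case True
  then show ?thesis by simp
next
  case False
  then have d: "infdist x C > 0"
    using assms by (simp add: infdist_pos_not_in_closed)
  obtain K where K: "1 / infdist x C < real K" using reals_Archimedean2 by blast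
  have "max 0 (1 - real k * infdist x C) = 0" if "k \<ge> K" for k
  proof -
    have "1 < real K * infdist x C" using K d by (simp add: field_simps)
    also have "\<dots> \<le> real k * infdist x C" using that d by (intro mult_right_mono) auto
    finally show ?thesis by simp
  qed
  then show ?thesis
    using False by (intro tendsto_eventually) (auto simp: eventually_sequentially)
qed

text \<open>The closure is enlarged in stages: bounded continuous functions by Stone-Weierstrass on
  the compact sphere, indicators of closed sets as their limits, indicators of Borel sets by
  Dynkin's theorem (closed sets are stable under intersection), and finally all of
  \<open>L^p\<close>.\<close>

lemma Lp_closure_sphere_eq_Lp_space:
  fixes S :: "('a::euclidean_space \<Rightarrow> real) set"
  assumes "Lp_subspace sphere_measure p S"
    and poly: "\<And>P. real_polynomial_function P \<Longrightarrow> P \<in> Lp_closure sphere_measure p S"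
  shows "Lp_closure sphere_measure p S = Lp_space sphere_measure p"
proof -
  let ?M = "sphere_measure :: 'a measure"
  interpret Lp_subspace ?M p S by fact
  interpret finite_measure ?M by (rule finite_measure_sphere_measure)
  have borel: "f \<in> borel_measurable ?M" if "f \<in> borel_measurable borel" for f :: "'a \<Rightarrow> real"
    using measurable_restrict_space1[OF that] measurable_cong_sets[OF sets_sphere_measure refl] by blast
  note dom = Lp_closure_dominated
  have cont: "f \<in> Lp_closure ?M p S" if f: "continuous_on UNIV f" and B: "\<And>x. \<bar>f x\<bar> \<le> B" for f :: "'a \<Rightarrow> real" and B
  proof -
    have "\<exists>P. real_polynomial_function P \<and> (\<forall>x\<in>sphere 0 1. \<bar>f x - P x\<bar> < inverse (real (Suc k)))" for k
      using Stone_Weierstrass_real_polynomial_function[of "sphere (0::'a) 1" f "inverse (real (Suc k))"]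
        continuous_on_subset[OF f]
      by (metis compact_sphere inverse_positive_iff_positive of_nat_0_less_iff subset_UNIV zero_less_Suc)
    then obtain P where P: "\<And>k. real_polynomial_function (P k)"
      "\<And>k x. x \<in> sphere 0 1 \<Longrightarrow> \<bar>f x - P k x\<bar> < inverse (real (Suc k))" by metis
    show ?thesis
    proof (rule dom[where s = P and w = "\<lambda>x. B + 1"])
      show "f \<in> borel_measurable ?M"
          by (intro borel borel_measurable_continuous_onI f)
      show "P k \<in> Lp_closure ?M p S" for k by (rule poly[OF P(1)])
      show "\<bar>P k x\<bar> \<le> B + 1" if "x \<in> space ?M" for k x
      proof -
        have "inverse (real (Suc k)) \<le> 1" by (simp add: inverse_le_1_iff)
        then show ?thesis using P(2)[of x k] B[of x] that by (simp add: space_sphere_measure)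
      qed
      have "(\<lambda>k. P k x) \<longlonglongrightarrow> f x" if "x \<in> space ?M" for x
      proof -
        have "(\<lambda>k. f x - P k x) \<longlonglongrightarrow> 0"
          using P(2)[of x] that
          by (intro Lim_null_comparison[OF _ LIMSEQ_inverse_real_of_nat])
            (auto simp: space_sphere_measure intro!: always_eventually less_imp_le)
        from tendsto_diff[OF tendsto_const[of "f x"] this] show ?thesis by simp
      qed
      then show "AE x in ?M. (\<lambda>k. P k x) \<longlonglongrightarrow> f x" by simp
    qed simp
  qed
  have one: "(\<lambda>x. 1) \<in> Lp_closure ?M p S" using poly by blast
  have clos: "indicator C \<in> Lp_closure ?M p S" if "closed C" for C :: "'a set"
  proof (cases "C = {}")
    case True
    then show ?thesis using Lp_closure_scale[OF one, of 0] by (simp add: indicator_def[abs_def])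
  next
    case False
    show ?thesis
    proof (rule dom[where s = "\<lambda>k x. max 0 (1 - real k * infdist x C)" and w = "\<lambda>x. 1"])
      show "(indicator C :: 'a \<Rightarrow> real) \<in> borel_measurable ?M"
          by (intro borel borel_measurable_indicator borel_closed that)
      show "(\<lambda>x. max 0 (1 - real k * infdist x C)) \<in> Lp_closure ?M p S" for k
        proof (rule cont[where B = 1])
        show "continuous_on UNIV (\<lambda>x. max 0 (1 - real k * infdist x C))"
          by (intro continuous_intros)
      qed (auto simp: infdist_nonneg abs_le_iff)
    qed (auto simp: infdist_nonneg indicator_closed_limit that False abs_le_iff)
  qed
  have "indicator A \<in> Lp_closure ?M p S" if "A \<in> sets borel" for A :: "'a set"
  proof -
    have "A \<in> sigma_sets UNIV (Collect closed)" using that by (simp add: borel_eq_closed)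
    then show ?thesis
    proof (induction rule: sigma_sets_induct_disjoint[rotated 2, consumes 1, case_names basic empty compl union])
      case (basic A)
      then show ?case using clos by simp
    next
      case empty
      show ?case by (rule clos) simp
    next
      case (compl A)
      have "(\<lambda>x. 1 + (-1) * indicator A x) \<in> Lp_closure ?M p S"
        by (intro Lp_closure_add one Lp_closure_scale compl.IH)
      then show ?case by (rule Lp_closure_cong) (simp add: indicator_def)
    next
      case (union A)
      have A: "A i \<in> sets borel" for i using union by (auto simp: borel_eq_closed)
      have "(\<lambda>x. \<Sum>i<k. indicator (A i) x) \<in> Lp_closure ?M p S" for k
      proof (induction k)
        case 0
        then show ?case using Lp_closure_scale[OF one, of 0] by simp
      next
        case (Suc k)
        then show ?case using Lp_closure_add[OF Suc union.IH[of k]] by (simp add: add_ac)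
      qed
      \<comment> \<open>By disjointness the sum of the indicators is the indicator of the finite
        union; these stay below 1 and converge to that of the countable union.\<close>
      then have fin: "indicator (\<Union>i<k. A i) \<in> Lp_closure ?M p S" for k
        by (rule Lp_closure_cong)
          (subst indicator_UN_disjoint, use union(1) in \<open>auto simp: disjoint_family_on_def\<close>)
      show ?case
      proof (rule dom[where s = "\<lambda>k. indicator (\<Union>i<k. A i)" and w = "\<lambda>x. 1"])
        show "(indicator (\<Union>i. A i) :: 'a \<Rightarrow> real) \<in> borel_measurable ?M"
          by (intro borel borel_measurable_indicator sets.countable_UN) (use A in auto)
        show "AE x in ?M. (\<lambda>k. indicator (\<Union>i<k. A i) x) \<longlonglongrightarrow> (indicator (\<Union>i. A i) x :: real)"
          by (intro AE_I2 LIMSEQ_indicator_UN)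
      qed (auto intro: fin simp: indicator_def)
    qed (auto simp: Int_stable_def)
  qed
  note all_borel = this
  have "indicator A \<in> Lp_closure ?M p S" if A: "A \<in> sets ?M" for A
  proof -
    obtain B where "B \<in> sets borel" "A = sphere 0 1 \<inter> B"
      using A by (auto simp: sets_sphere_measure sets_restrict_space)
    then have "A \<in> sets borel" by auto
    then show ?thesis by (rule all_borel)
  qed
  then show ?thesis by (rule Lp_closure_eq_Lp_space)
qed

lemma real_polynomial_function_Lp_space_sphere:
  fixes P :: "'a::euclidean_space \<Rightarrow> real"
  assumes "0 < p" "real_polynomial_function P"
  shows "P \<in> Lp_space sphere_measure p"
proof -
  interpret finite_measure "sphere_measure :: 'a measure" by (rule finite_measure_sphere_measure)
  have cont: "continuous_on UNIV P"
    using assms(2) by (simp add: continuous_on_polymonial_function real_polynomial_function_eq)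
  then have meas [measurable]: "P \<in> borel_measurable sphere_measure"
    using measurable_restrict_space1[OF borel_measurable_continuous_onI]
      measurable_cong_sets[OF sets_sphere_measure refl] by blast
  have "bounded (P ` sphere 0 1)"
    by (intro compact_imp_bounded compact_continuous_image continuous_on_subset[OF cont]) auto
  then obtain B where "\<forall>x\<in>sphere 0 1. \<bar>P x\<bar> \<le> B" by (auto simp: bounded_iff)
  then have "AE x in sphere_measure. norm (\<bar>P x\<bar> powr p) \<le> B powr p"
    using assms(1) by (auto simp: space_sphere_measure intro!: AE_I2 powr_mono2)
  then have "integrable sphere_measure (\<lambda>x. \<bar>P x\<bar> powr p)"
    by (rule integrable_const_bound) simp
  then show ?thesis by (simp add: Lp_space_def)
qed

theorem corollary4:
  fixes p :: real and m :: nat and x0 :: "real ^ 'n"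
  assumes "CARD('n) \<ge> 2" and "0 < p" and "0 < m" and "x0 \<in> sphere 0 1"
  shows "dense_in_Lp sphere_measure p (harmonic_polys_vanishing m x0)"
proof -
  let ?M = "sphere_measure :: (real ^ 'n) measure" and ?S = "harmonic_polys_vanishing m x0"
  have x0: "norm x0 = 1" using assms(4) by simp
  interpret finite_measure ?M by (rule finite_measure_sphere_measure)
  interpret Lp_subspace ?M p ?S
  proof
    show "?S \<subseteq> Lp_space ?M p"
      using real_polynomial_function_Lp_space_sphere[OF assms(2)]
      by (auto simp: harmonic_polys_vanishing_def harmonic_polynomials_def)
  qed (use assms(2) in \<open>auto intro: harmonic_polys_vanishing_add harmonic_polys_vanishing_scale\<close>)
  \<comment> \<open>\<open>P\<close> is replaced by a harmonic \<open>h\<close> with the same values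
    on the sphere; \<open>h\<close> is a bounded limit of members of \<open>?S\<close> off the null
    set \<open>{x0}\<close>.\<close>
  have "P \<in> Lp_closure ?M p ?S" if P: "real_polynomial_function P" for P
  proof -
    obtain h where h: "h \<in> harmonic_polynomials" "\<And>x. x \<in> sphere 0 1 \<Longrightarrow> h x = P x"
      using real_polynomial_function_eq_harmonic_on_sphere[OF P] by blast
    obtain g B where g: "\<And>N. g N \<in> ?S" "\<And>N x. x \<in> sphere 0 1 \<Longrightarrow> \<bar>g N x\<bar> \<le> B"
      "\<And>x. x \<in> sphere 0 1 - {x0} \<Longrightarrow> (\<lambda>N. g N x) \<longlonglongrightarrow> h x"
      using wave_span_limit_vanishing[OF harmonic_wave_span[OF assms(1) x0 h(1)] x0, of m] by blast
    have "h \<in> Lp_closure ?M p ?S"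
    proof (rule Lp_closure_dominated[where s = g and w = "\<lambda>x. B"])
      show "h \<in> borel_measurable ?M"
        using real_polynomial_function_Lp_space_sphere[OF assms(2) harmonic_polynomials_real_polynomial_function[OF h(1)]]
        by (simp add: Lp_space_def)
      show "g N \<in> Lp_closure ?M p ?S" for N
        using Lp_closure_superset[OF S] g(1) by blast
      have "AE x in ?M. x \<noteq> x0"
        using assms(1) x0 by (intro AE_sphere_measure_neq) simp_all
      then show "AE x in ?M. (\<lambda>N. g N x) \<longlonglongrightarrow> h x"
        using AE_space by eventually_elim (simp add: g(3) space_sphere_measure)
    qed (simp_all add: g(2) space_sphere_measure)
    then show ?thesis by (rule Lp_closure_cong) (simp add: h(2) space_sphere_measure)
  qed
  from Lp_closure_sphere_eq_Lp_space[OF Lp_subspace_axioms this]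
  show ?thesis
    using S by (auto simp: dense_in_Lp_def Lp_closure_def)
qed

end
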